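(* Let $\mathrm L$ be a semilinear core expansion of $\mathrm{MTL}$ that is not an $\mathrm{SMTL}$ logic. For every formula $\varphi$ in the language of classical propositional logic $\mathbf{CPL}$, with $\{p_1,\ldots,p_n\}$ the set of propositional variables occurring in $\varphi$, $$\vdash_{\mathbf{CPL}}\varphi\quad\text{iff there is } k\geq 1 \text{ such that}\quad \vdash_{\mathrm L_\circ^{dat}}\Big(\bigwedge_{i=1}^n\circ p_i\Big)^k\to\varphi ,$$ where $\psi^k$ is shorthand for $\psi\,\&\cdots\&\,\psi$ ($k$ times).
   Context: $\mathrm{MTL}$: formulas are built from countably many propositional variables with binary connectives $\wedge,\&,\to$ and the constant $\overline 0$; $\neg\varphi:=\varphi\to\overline 0$, $\overline 1:=\neg\overline 0$, $\varphi\vee\psi:=((\varphi\to\psi)\to\psi)\wedge((\psi\to\varphi)\to\varphi)$, $\varphi\leftrightarrow\psi:=(\varphi\to\psi)\wedge(\psi\to\varphi)$. Its axiom schemata are $(\varphi\to\psi)\to((\psi\to\chi)\to(\varphi\to\chi))$; $\varphi\&\psi\to\varphi$; $\varphi\&\psi\to\psi\&\varphi$; $\varphi\wedge\psi\to\varphi$; $\varphi\wedge\psi\to\psi\wedge\varphi$; $\varphi\&(\varphi\to\psi)\to\varphi\wedge\psi$; $(\varphi\to(\psi\to\chi))\to(\varphi\&\psi\to\chi)$; $(\varphi\&\psi\to\chi)\to(\varphi\to(\psi\to\chi))$; $((\varphi\to\psi)\to\chi)\to(((\psi\to\varphi)\to\chi)\to\chi)$; $\overline 0\to\varphi$; its only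 rule is modus ponens. An $\mathrm{MTL}$-algebra is a commutative bounded integral residuated lattice $\langle A,\wedge,\vee,\&,\to,0,1\rangle$ with $(x\to y)\vee(y\to x)=1$. A core expansion of $\mathrm{MTL}$ is a finitary logic $\mathrm L$ obtained from $\mathrm{MTL}$ by possibly adding new connectives, axiom schemata and finitary rule schemata, such that for each new $n$-ary connective $c$ and each argument place, $\varphi\to\psi,\psi\to\varphi\vdash_{\mathrm L}c(\ldots,\varphi,\ldots)\to c(\ldots,\psi,\ldots)$. An $\mathrm L$-algebra is an $\mathrm{MTL}$-algebra with operations interpreting the new connectives such that, under every evaluation, all axioms of $\mathrm L$ get value $1$ and all rules of $\mathrm L$ preserve the value $1$; an $\mathrm L$-chain is a linearly ordered one. $\mathrm L$ is semilinear if it is strongly complete w.r.t. $\mathrm L$-chains. "$\mathrm L$ is not an $\mathrm{SMTL}$ logic" means that $\mathrm L$ does not prove the schema $\varphi\wedge\neg\varphi\to\overline 0$. The logic $\mathrm L_\circ$ is the expansion of (an axiomatization of) $\mathrm L$ with a new unary connective $\circ$, the axioms $\neg(\varphi\wedge\neg\varphi\wedge\circ\varphi)$, $\circ\overline 1$, $\circ\overline 0$, and the rules (Cong): from $(\varphi\leftrightarrow\psi)\vee\delta$ derive $(\circ\varphi\leftrightarrow\circ\psi)\vee\delta$; (Coh): from $(\neg\neg\varphi\wedge(\varphi\to\psi))\vee\delta$ derive $(\circ\varphi\to\circ\psi)\vee\delta$ (all schemata being in the expanded language). $\mathrm L_\circ^{dat}$ is the axiomatic extension of $\mathrm L_\circ$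 with the axiom $\circ\varphi\to(\varphi\vee\neg\varphi)$. Formulas in the language of $\mathbf{CPL}$ are those built with the connectives of $\mathrm{MTL}$ ($\wedge,\vee,\to,\neg,\overline 0$, and also $\&$), where in $\mathbf{CPL}$ both $\wedge$ and $\&$ are read as classical conjunction. When $n=0$, $\bigwedge_{i=1}^n\circ p_i$ is $\overline 1$. *)

theory Defs
  imports "HOL-Algebra.Group"
begin

section \<open>Formulas\<close>

text \<open>The type \<open>'c\<close> supplies names for connectives beyond the primitive ones of MTL.
  A language is an arity map \<open>ar :: 'c \<rightharpoonup> nat\<close>, whose domain is the set of connectives that are
  actually present; in particular the language of MTL (and of CPL) is the empty map.\<close>

datatype 'c fm =
    Var nat
  | Bot  (\<open>\<^bold>0\<close>)
  | And "'c fm" "'c fm"  (infixl \<open>\<^bold>\<and>\<close> 75)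
  | Fuse "'c fm" "'c fm"  (infixl \<open>\<^bold>&\<close> 75)
  | Imp "'c fm" "'c fm"  (infixr \<open>\<^bold>\<rightarrow>\<close> 70)
  | Op 'c "'c fm list"

abbreviation Neg :: "'c fm \<Rightarrow> 'c fm"  (\<open>\<^bold>\<not> _\<close> [80] 80)
  where "\<^bold>\<not> \<phi> \<equiv> \<phi> \<^bold>\<rightarrow> \<^bold>0"

abbreviation Top :: "'c fm"  (\<open>\<^bold>1\<close>)
  where "\<^bold>1 \<equiv> \<^bold>\<not> \<^bold>0"

abbreviation Or :: "'c fm \<Rightarrow> 'c fm \<Rightarrow> 'c fm"  (infixl \<open>\<^bold>\<or>\<close> 73)
  where "\<phi> \<^bold>\<or> \<psi> \<equiv> ((\<phi> \<^bold>\<rightarrow> \<psi>) \<^bold>\<rightarrow> \<psi>) \<^bold>\<and> ((\<psi> \<^bold>\<rightarrow> \<phi>) \<^bold>\<rightarrow> \<phi>)"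

abbreviation Iff :: "'c fm \<Rightarrow> 'c fm \<Rightarrow> 'c fm"  (infix \<open>\<^bold>\<leftrightarrow>\<close> 68)
  where "\<phi> \<^bold>\<leftrightarrow> \<psi> \<equiv> (\<phi> \<^bold>\<rightarrow> \<psi>) \<^bold>\<and> (\<psi> \<^bold>\<rightarrow> \<phi>)"

primrec wff :: "('c \<rightharpoonup> nat) \<Rightarrow> 'c fm \<Rightarrow> bool" where
  "wff ar (Var n) \<longleftrightarrow> True"
| "wff ar \<^bold>0 \<longleftrightarrow> True"
| "wff ar (\<phi> \<^bold>\<and> \<psi>) \<longleftrightarrow> wff ar \<phi> \<and> wff ar \<psi>"
| "wff ar (\<phi> \<^bold>& \<psi>) \<longleftrightarrow> wff ar \<phi> \<and> wff ar \<psi>"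
| "wff ar (\<phi> \<^bold>\<rightarrow> \<psi>) \<longleftrightarrow> wff ar \<phi> \<and> wff ar \<psi>"
| "wff ar (Op c \<phi>s) \<longleftrightarrow> ar c = Some (length \<phi>s) \<and> list_all (wff ar) \<phi>s"

primrec vars :: "'c fm \<Rightarrow> nat set" where
  "vars (Var n) = {n}"
| "vars \<^bold>0 = {}"
| "vars (\<phi> \<^bold>\<and> \<psi>) = vars \<phi> \<union> vars \<psi>"
| "vars (\<phi> \<^bold>& \<psi>) = vars \<phi> \<union> vars \<psi>"
| "vars (\<phi> \<^bold>\<rightarrow> \<psi>) = vars \<phi> \<union> vars \<psi>"
| "vars (Op c \<phi>s) = \<Union> (set (map vars \<phi>s))"

primrec subst :: "(nat \<Rightarrow> 'c fm) \<Rightarrow> 'c fm \<Rightarrow> 'c fm" where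
  "subst \<sigma> (Var n) = \<sigma> n"
| "subst \<sigma> \<^bold>0 = \<^bold>0"
| "subst \<sigma> (\<phi> \<^bold>\<and> \<psi>) = subst \<sigma> \<phi> \<^bold>\<and> subst \<sigma> \<psi>"
| "subst \<sigma> (\<phi> \<^bold>& \<psi>) = subst \<sigma> \<phi> \<^bold>& subst \<sigma> \<psi>"
| "subst \<sigma> (\<phi> \<^bold>\<rightarrow> \<psi>) = subst \<sigma> \<phi> \<^bold>\<rightarrow> subst \<sigma> \<psi>"
| "subst \<sigma> (Op c \<phi>s) = Op c (map (subst \<sigma>) \<phi>s)"

text \<open>The value at exponent \<open>0\<close> is only a convention; the powers of interest have exponent \<open>\<ge> 1\<close>.\<close>

fun fpow :: "'c fm \<Rightarrow> nat \<Rightarrow> 'c fm" where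
  "fpow \<psi> 0 = \<^bold>1"
| "fpow \<psi> (Suc 0) = \<psi>"
| "fpow \<psi> (Suc (Suc k)) = fpow \<psi> (Suc k) \<^bold>& \<psi>"

fun big_and :: "'c fm list \<Rightarrow> 'c fm" where
  "big_and [] = \<^bold>1"
| "big_and [\<phi>] = \<phi>"
| "big_and (\<phi> # \<psi> # \<phi>s) = \<phi> \<^bold>\<and> big_and (\<psi> # \<phi>s)"


section \<open>Logics presented by schemata\<close>

text \<open>Schemata are formulas whose propositional variables play the role of metavariables; their
  instances are obtained by substituting formulas of the language. A rule schema is a pair of a
  finite set of premises and a conclusion.\<close>

record 'c logic =
  arity :: "'c \<rightharpoonup> nat"
  axioms :: "'c fm set"
  rules :: "('c fm set \<times> 'c fm) set"

definition well_formed_logic :: "'c logic \<Rightarrow> bool" where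
  "well_formed_logic L \<longleftrightarrow>
     (\<forall>\<alpha> \<in> axioms L. wff (arity L) \<alpha>) \<and>
     (\<forall>(P, \<gamma>) \<in> rules L. finite P \<and> (\<forall>\<pi> \<in> P. wff (arity L) \<pi>) \<and> wff (arity L) \<gamma>)"

inductive derives :: "'c logic \<Rightarrow> 'c fm set \<Rightarrow> 'c fm \<Rightarrow> bool"  for L \<Gamma> where
  hypothesis: "\<lbrakk>\<phi> \<in> \<Gamma>; wff (arity L) \<phi>\<rbrakk> \<Longrightarrow> derives L \<Gamma> \<phi>"
| axiom_instance: "\<lbrakk>\<alpha> \<in> axioms L; \<And>n. wff (arity L) (\<sigma> n)\<rbrakk> \<Longrightarrow> derives L \<Gamma> (subst \<sigma> \<alpha>)"
| rule_instance: "\<lbrakk>(P, \<gamma>) \<in> rules L; \<And>n. wff (arity L) (\<sigma> n);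
      \<And>\<pi>. \<pi> \<in> P \<Longrightarrow> derives L \<Gamma> (subst \<sigma> \<pi>)\<rbrakk> \<Longrightarrow> derives L \<Gamma> (subst \<sigma> \<gamma>)"

abbreviation "theorem_of" :: "'c logic \<Rightarrow> 'c fm \<Rightarrow> bool"  (\<open>\<turnstile>\<^bsub>_\<^esub> _\<close> [0, 60] 60)
  where "\<turnstile>\<^bsub>L\<^esub> \<phi> \<equiv> derives L {} \<phi>"

definition modus_ponens :: "'c fm set \<times> 'c fm" where
  "modus_ponens = ({Var 0, Var 0 \<^bold>\<rightarrow> Var 1}, Var 1)"

definition mtl_axioms :: "'c fm set" where
  "mtl_axioms = (let \<phi> = Var 0; \<psi> = Var 1; \<chi> = Var 2 in
     {(\<phi> \<^bold>\<rightarrow> \<psi>) \<^bold>\<rightarrow> ((\<psi> \<^bold>\<rightarrow> \<chi>) \<^bold>\<rightarrow> (\<phi> \<^bold>\<rightarrow> \<chi>)),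
      \<phi> \<^bold>& \<psi> \<^bold>\<rightarrow> \<phi>,
      \<phi> \<^bold>& \<psi> \<^bold>\<rightarrow> \<psi> \<^bold>& \<phi>,
      \<phi> \<^bold>\<and> \<psi> \<^bold>\<rightarrow> \<phi>,
      \<phi> \<^bold>\<and> \<psi> \<^bold>\<rightarrow> \<psi> \<^bold>\<and> \<phi>,
      \<phi> \<^bold>& (\<phi> \<^bold>\<rightarrow> \<psi>) \<^bold>\<rightarrow> \<phi> \<^bold>\<and> \<psi>,
      (\<phi> \<^bold>\<rightarrow> (\<psi> \<^bold>\<rightarrow> \<chi>)) \<^bold>\<rightarrow> (\<phi> \<^bold>& \<psi> \<^bold>\<rightarrow> \<chi>),
      (\<phi> \<^bold>& \<psi> \<^bold>\<rightarrow> \<chi>) \<^bold>\<rightarrow> (\<phi> \<^bold>\<rightarrow> (\<psi> \<^bold>\<rightarrow> \<chi>)),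
      ((\<phi> \<^bold>\<rightarrow> \<psi>) \<^bold>\<rightarrow> \<chi>) \<^bold>\<rightarrow> (((\<psi> \<^bold>\<rightarrow> \<phi>) \<^bold>\<rightarrow> \<chi>) \<^bold>\<rightarrow> \<chi>),
      \<^bold>0 \<^bold>\<rightarrow> \<phi>})"

definition core_expansion_of_mtl :: "'c logic \<Rightarrow> bool" where
  "core_expansion_of_mtl L \<longleftrightarrow>
     well_formed_logic L \<and> mtl_axioms \<subseteq> axioms L \<and> modus_ponens \<in> rules L \<and>
     (\<forall>c n \<phi>s i \<phi> \<psi>. arity L c = Some n \<longrightarrow> length \<phi>s = n \<longrightarrow> i < n \<longrightarrow>
        list_all (wff (arity L)) \<phi>s \<longrightarrow> wff (arity L) \<phi> \<longrightarrow> wff (arity L) \<psi> \<longrightarrow>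
        derives L {\<phi> \<^bold>\<rightarrow> \<psi>, \<psi> \<^bold>\<rightarrow> \<phi>} (Op c (\<phi>s[i := \<phi>]) \<^bold>\<rightarrow> Op c (\<phi>s[i := \<psi>])))"

definition smtl_logic :: "'c logic \<Rightarrow> bool" where
  "smtl_logic L \<longleftrightarrow> (\<forall>\<phi>. wff (arity L) \<phi> \<longrightarrow> \<turnstile>\<^bsub>L\<^esub> \<phi> \<^bold>\<and> \<^bold>\<not> \<phi> \<^bold>\<rightarrow> \<^bold>0)"

text \<open>A Hilbert calculus for classical propositional logic over the primitives of MTL, with the
  same introduction and elimination axioms for the two conjunctions.\<close>

definition cpl :: "'c logic" where
  "cpl = \<lparr>arity = Map.empty,
     axioms = (let \<phi> = Var 0; \<psi> = Var 1; \<chi> = Var 2 in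
       {\<phi> \<^bold>\<rightarrow> (\<psi> \<^bold>\<rightarrow> \<phi>),
        (\<phi> \<^bold>\<rightarrow> (\<psi> \<^bold>\<rightarrow> \<chi>)) \<^bold>\<rightarrow> ((\<phi> \<^bold>\<rightarrow> \<psi>) \<^bold>\<rightarrow> (\<phi> \<^bold>\<rightarrow> \<chi>)),
        \<phi> \<^bold>\<and> \<psi> \<^bold>\<rightarrow> \<phi>, \<phi> \<^bold>\<and> \<psi> \<^bold>\<rightarrow> \<psi>, \<phi> \<^bold>\<rightarrow> (\<psi> \<^bold>\<rightarrow> \<phi> \<^bold>\<and> \<psi>),
        \<phi> \<^bold>& \<psi> \<^bold>\<rightarrow> \<phi>, \<phi> \<^bold>& \<psi> \<^bold>\<rightarrow> \<psi>, \<phi> \<^bold>\<rightarrow> (\<psi> \<^bold>\<rightarrow> \<phi> \<^bold>& \<psi>),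
        \<^bold>0 \<^bold>\<rightarrow> \<phi>,
        \<^bold>\<not> \<^bold>\<not> \<phi> \<^bold>\<rightarrow> \<phi>}),
     rules = {modus_ponens}\<rparr>"


section \<open>Algebras and semilinearity\<close>

text \<open>The inherited monoid \<open>(\<otimes>, \<one>)\<close> interprets \<open>&\<close> and the constant \<open>1\<close>. Operations
  interpreting additional connectives take their arguments as a list.\<close>

record ('a, 'c) alg = "'a monoid" +
  mt :: "'a \<Rightarrow> 'a \<Rightarrow> 'a"  (infixl \<open>\<^bold>\<sqinter>\<index>\<close> 70)
  jn :: "'a \<Rightarrow> 'a \<Rightarrow> 'a"  (infixl \<open>\<^bold>\<squnion>\<index>\<close> 65)
  residuum :: "'a \<Rightarrow> 'a \<Rightarrow> 'a"  (infixr \<open>\<leadsto>\<index>\<close> 68)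
  zer :: 'a  (\<open>\<^bold>\<bottom>\<index>\<close>)
  ops :: "'c \<Rightarrow> 'a list \<Rightarrow> 'a"

definition below :: "('a, 'c) alg \<Rightarrow> 'a \<Rightarrow> 'a \<Rightarrow> bool"  (\<open>_ \<preceq>\<index> _\<close> [51, 51] 50)
  where "x \<preceq>\<^bsub>A\<^esub> y \<longleftrightarrow> x \<^bold>\<sqinter>\<^bsub>A\<^esub> y = x"

locale mtl_algebra = comm_monoid A for A :: "('a, 'c) alg" (structure) +
  assumes mt_closed: "\<lbrakk>x \<in> carrier A; y \<in> carrier A\<rbrakk> \<Longrightarrow> x \<^bold>\<sqinter> y \<in> carrier A"
    and jn_closed: "\<lbrakk>x \<in> carrier A; y \<in> carrier A\<rbrakk> \<Longrightarrow> x \<^bold>\<squnion> y \<in> carrier A"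
    and residuum_closed: "\<lbrakk>x \<in> carrier A; y \<in> carrier A\<rbrakk> \<Longrightarrow> x \<leadsto> y \<in> carrier A"
    and zer_closed: "\<^bold>\<bottom> \<in> carrier A"
    and mt_assoc: "\<lbrakk>x \<in> carrier A; y \<in> carrier A; z \<in> carrier A\<rbrakk>
          \<Longrightarrow> x \<^bold>\<sqinter> y \<^bold>\<sqinter> z = x \<^bold>\<sqinter> (y \<^bold>\<sqinter> z)"
    and mt_comm: "\<lbrakk>x \<in> carrier A; y \<in> carrier A\<rbrakk> \<Longrightarrow> x \<^bold>\<sqinter> y = y \<^bold>\<sqinter> x"
    and jn_assoc: "\<lbrakk>x \<in> carrier A; y \<in> carrier A; z \<in> carrier A\<rbrakk>
          \<Longrightarrow> x \<^bold>\<squnion> y \<^bold>\<squnion> z = x \<^bold>\<squnion> (y \<^bold>\<squnion> z)"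
    and jn_comm: "\<lbrakk>x \<in> carrier A; y \<in> carrier A\<rbrakk> \<Longrightarrow> x \<^bold>\<squnion> y = y \<^bold>\<squnion> x"
    and mt_absorb: "\<lbrakk>x \<in> carrier A; y \<in> carrier A\<rbrakk> \<Longrightarrow> x \<^bold>\<sqinter> (x \<^bold>\<squnion> y) = x"
    and jn_absorb: "\<lbrakk>x \<in> carrier A; y \<in> carrier A\<rbrakk> \<Longrightarrow> x \<^bold>\<squnion> (x \<^bold>\<sqinter> y) = x"
    and zer_below: "x \<in> carrier A \<Longrightarrow> \<^bold>\<bottom> \<preceq> x"
    and below_one: "x \<in> carrier A \<Longrightarrow> x \<preceq> \<one>"
    and residuation: "\<lbrakk>x \<in> carrier A; y \<in> carrier A; z \<in> carrier A\<rbrakk>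
          \<Longrightarrow> x \<otimes> y \<preceq> z \<longleftrightarrow> x \<preceq> y \<leadsto> z"
    and prelinear: "\<lbrakk>x \<in> carrier A; y \<in> carrier A\<rbrakk> \<Longrightarrow> (x \<leadsto> y) \<^bold>\<squnion> (y \<leadsto> x) = \<one>"

primrec eval :: "('a, 'c) alg \<Rightarrow> (nat \<Rightarrow> 'a) \<Rightarrow> 'c fm \<Rightarrow> 'a" where
  "eval A e (Var n) = e n"
| "eval A e \<^bold>0 = \<^bold>\<bottom>\<^bsub>A\<^esub>"
| "eval A e (\<phi> \<^bold>\<and> \<psi>) = eval A e \<phi> \<^bold>\<sqinter>\<^bsub>A\<^esub> eval A e \<psi>"
| "eval A e (\<phi> \<^bold>& \<psi>) = eval A e \<phi> \<otimes>\<^bsub>A\<^esub> eval A e \<psi>"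
| "eval A e (\<phi> \<^bold>\<rightarrow> \<psi>) = eval A e \<phi> \<leadsto>\<^bsub>A\<^esub> eval A e \<psi>"
| "eval A e (Op c \<phi>s) = ops A c (map (eval A e) \<phi>s)"

abbreviation evaluation :: "('a, 'c) alg \<Rightarrow> (nat \<Rightarrow> 'a) \<Rightarrow> bool" where
  "evaluation A e \<equiv> range e \<subseteq> carrier A"

text \<open>It suffices to evaluate the schemata themselves: the value of an instance \<open>subst \<sigma> \<alpha>\<close>
  under \<open>e\<close> is the value of \<open>\<alpha>\<close> under the evaluation \<open>eval A e \<circ> \<sigma>\<close>.\<close>

definition is_algebra :: "'c logic \<Rightarrow> ('a, 'c) alg \<Rightarrow> bool" where
  "is_algebra L A \<longleftrightarrow>
     mtl_algebra A \<and>
     (\<forall>c n xs. arity L c = Some n \<longrightarrow> length xs = n \<longrightarrow> set xs \<subseteq> carrier A \<longrightarrow>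
        ops A c xs \<in> carrier A) \<and>
     (\<forall>e. evaluation A e \<longrightarrow> (\<forall>\<alpha> \<in> axioms L. eval A e \<alpha> = \<one>\<^bsub>A\<^esub>)) \<and>
     (\<forall>e. evaluation A e \<longrightarrow>
        (\<forall>(P, \<gamma>) \<in> rules L. (\<forall>\<pi> \<in> P. eval A e \<pi> = \<one>\<^bsub>A\<^esub>) \<longrightarrow> eval A e \<gamma> = \<one>\<^bsub>A\<^esub>))"

definition is_chain :: "'c logic \<Rightarrow> ('a, 'c) alg \<Rightarrow> bool" where
  "is_chain L A \<longleftrightarrow>
     is_algebra L A \<and> (\<forall>x \<in> carrier A. \<forall>y \<in> carrier A. x \<preceq>\<^bsub>A\<^esub> y \<or> y \<preceq>\<^bsub>A\<^esub> x)"

definition chain_consequence ::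
    "'a itself \<Rightarrow> 'c logic \<Rightarrow> 'c fm set \<Rightarrow> 'c fm \<Rightarrow> bool" where
  "chain_consequence TYPE('a) L \<Gamma> \<phi> \<longleftrightarrow>
     (\<forall>(A :: ('a, 'c) alg) e. is_chain L A \<longrightarrow> evaluation A e \<longrightarrow>
        (\<forall>\<gamma> \<in> \<Gamma>. eval A e \<gamma> = \<one>\<^bsub>A\<^esub>) \<longrightarrow> eval A e \<phi> = \<one>\<^bsub>A\<^esub>)"

text \<open>Chains are taken with carriers inside the type \<open>'c fm set\<close>. This is no restriction: as
  \<open>chain_consequence_any_type\<close> below shows, consequence over these chains implies consequence over
  the chains in any other type.\<close>

definition semilinear :: "'c logic \<Rightarrow> bool" where
  "semilinear L \<longleftrightarrow>
     (\<forall>\<Gamma> \<phi>. (\<forall>\<gamma> \<in> \<Gamma>. wff (arity L) \<gamma>) \<longrightarrow> wff (arity L) \<phi> \<longrightarrow>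
        (derives L \<Gamma> \<phi> \<longleftrightarrow> chain_consequence TYPE('c fm set) L \<Gamma> \<phi>))"


lemma eval_in_subuniverse:
  assumes "\<And>x y. \<lbrakk>x \<in> S; y \<in> S\<rbrakk> \<Longrightarrow> x \<^bold>\<sqinter>\<^bsub>A\<^esub> y \<in> S"
    and "\<And>x y. \<lbrakk>x \<in> S; y \<in> S\<rbrakk> \<Longrightarrow> x \<otimes>\<^bsub>A\<^esub> y \<in> S"
    and "\<And>x y. \<lbrakk>x \<in> S; y \<in> S\<rbrakk> \<Longrightarrow> x \<leadsto>\<^bsub>A\<^esub> y \<in> S"
    and "\<^bold>\<bottom>\<^bsub>A\<^esub> \<in> S"
    and "\<And>c xs. \<lbrakk>ar c = Some (length xs); set xs \<subseteq> S\<rbrakk> \<Longrightarrow> ops A c xs \<in> S"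
    and "range e \<subseteq> S"
  shows "wff ar \<phi> \<Longrightarrow> eval A e \<phi> \<in> S"
  using assms(6)
  by (induction \<phi>) (auto simp: assms(1-4) list_all_iff intro!: assms(5))

lemma chain_consequence_any_type:
  fixes L :: "'c logic"
  assumes L: "well_formed_logic L"
    and \<Gamma>: "\<forall>\<gamma> \<in> \<Gamma>. wff (arity L) \<gamma>" and \<phi>: "wff (arity L) \<phi>"
    and cons: "chain_consequence TYPE('c fm set) L \<Gamma> \<phi>"
  shows "chain_consequence TYPE('b) L \<Gamma> \<phi>"
  unfolding chain_consequence_def
proof (intro allI impI)
  fix A :: "('b, 'c) alg" and e
  assume chain: "is_chain L A" and e: "evaluation A e" and prem: "\<forall>\<gamma> \<in> \<Gamma>. eval A e \<gamma> = \<one>\<^bsub>A\<^esub>"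
  have alg: "is_algebra L A" using chain by (simp add: is_chain_def)
  interpret A: mtl_algebra A using alg by (simp add: is_algebra_def)
  have ops: "ops A c xs \<in> carrier A" if "arity L c = Some (length xs)" "set xs \<subseteq> carrier A" for c xs
    using alg that by (auto simp: is_algebra_def)
  have A_axiom: "eval A f \<alpha> = \<one>\<^bsub>A\<^esub>" if "evaluation A f" "\<alpha> \<in> axioms L" for f \<alpha>
  proof -
    have "\<forall>e. evaluation A e \<longrightarrow> (\<forall>\<alpha> \<in> axioms L. eval A e \<alpha> = \<one>\<^bsub>A\<^esub>)"
      using alg unfolding is_algebra_def by (elim conjE)
    then show ?thesis using that by blast
  qed
  have A_rule: "eval A f \<gamma> = \<one>\<^bsub>A\<^esub>"
    if "evaluation A f" "(P, \<gamma>) \<in> rules L" "\<And>\<pi>. \<pi> \<in> P \<Longrightarrow> eval A f \<pi> = \<one>\<^bsub>A\<^esub>" for f P \<gamma>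
  proof -
    have "\<forall>e. evaluation A e \<longrightarrow> (\<forall>(P, \<gamma>) \<in> rules L.
        (\<forall>\<pi> \<in> P. eval A e \<pi> = \<one>\<^bsub>A\<^esub>) \<longrightarrow> eval A e \<gamma> = \<one>\<^bsub>A\<^esub>)"
      using alg unfolding is_algebra_def by (elim conjE)
    from bspec[OF mp[OF spec[OF this] that(1)] that(2)] that(3) show ?thesis by simp
  qed
  define S where "S = eval A e ` {\<psi>. wff (arity L) \<psi>}"
  define h where "h a = {\<psi>. wff (arity L) \<psi> \<and> eval A e \<psi> = a}" for a
  define g where "g = inv_into S h"
  define B :: "('c fm set, 'c) alg" where
    "B = \<lparr>carrier = h ` S, mult = (\<lambda>x y. h (g x \<otimes>\<^bsub>A\<^esub> g y)), one = h \<one>\<^bsub>A\<^esub>,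
          mt = (\<lambda>x y. h (g x \<^bold>\<sqinter>\<^bsub>A\<^esub> g y)), jn = (\<lambda>x y. h (g x \<^bold>\<squnion>\<^bsub>A\<^esub> g y)),
          residuum = (\<lambda>x y. h (g x \<leadsto>\<^bsub>A\<^esub> g y)), zer = h \<^bold>\<bottom>\<^bsub>A\<^esub>,
          ops = (\<lambda>c xs. h (ops A c (map g xs)))\<rparr>"
  have S_carrier: "S \<subseteq> carrier A"
    unfolding S_def
    using eval_in_subuniverse[of "carrier A" A "arity L" e] A.mt_closed A.m_closed
      A.residuum_closed A.zer_closed ops e by blast
  have SA: "x \<in> carrier A" if "x \<in> S" for x using that S_carrier by blast
  have inj: "inj_on h S"
    unfolding inj_on_def S_def h_def by blast
  have gh: "g (h x) = x" if "x \<in> S" for x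
    using inj that by (simp add: g_def)
  have h_eq: "h x = h y \<longleftrightarrow> x = y" if "x \<in> S" "y \<in> S" for x y
    using inj that by (auto simp: inj_on_def)
  have S_mt: "x \<^bold>\<sqinter>\<^bsub>A\<^esub> y \<in> S" if xy: "x \<in> S" "y \<in> S" for x y
  proof -
    obtain \<alpha> \<beta> where "wff (arity L) \<alpha>" "x = eval A e \<alpha>" "wff (arity L) \<beta>" "y = eval A e \<beta>"
      using xy unfolding S_def by blast
    then show ?thesis by (auto simp: S_def intro!: image_eqI[of _ _ "\<alpha> \<^bold>\<and> \<beta>"])
  qed
  have S_mult: "x \<otimes>\<^bsub>A\<^esub> y \<in> S" if xy: "x \<in> S" "y \<in> S" for x y
  proof -
    obtain \<alpha> \<beta> where "wff (arity L) \<alpha>" "x = eval A e \<alpha>" "wff (arity L) \<beta>" "y = eval A e \<beta>"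
      using xy unfolding S_def by blast
    then show ?thesis by (auto simp: S_def intro!: image_eqI[of _ _ "\<alpha> \<^bold>& \<beta>"])
  qed
  have S_res: "x \<leadsto>\<^bsub>A\<^esub> y \<in> S" if xy: "x \<in> S" "y \<in> S" for x y
  proof -
    obtain \<alpha> \<beta> where "wff (arity L) \<alpha>" "x = eval A e \<alpha>" "wff (arity L) \<beta>" "y = eval A e \<beta>"
      using xy unfolding S_def by blast
    then show ?thesis by (auto simp: S_def intro!: image_eqI[of _ _ "\<alpha> \<^bold>\<rightarrow> \<beta>"])
  qed
  have S_zer: "\<^bold>\<bottom>\<^bsub>A\<^esub> \<in> S"
    by (auto simp: S_def intro!: image_eqI[of _ _ "\<^bold>0"])
  have S_ops: "ops A c xs \<in> S" if c: "arity L c = Some (length xs)" and xs: "set xs \<subseteq> S" for c xs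
  proof -
    have "\<exists>\<psi>s. map (eval A e) \<psi>s = xs \<and> list_all (wff (arity L)) \<psi>s"
      using xs
    proof (induction xs)
      case (Cons x xs)
      then obtain \<psi>s \<psi> where "map (eval A e) \<psi>s = xs" "list_all (wff (arity L)) \<psi>s"
        "wff (arity L) \<psi>" "eval A e \<psi> = x"
        by (auto simp: S_def)
      then show ?case by (intro exI[of _ "\<psi> # \<psi>s"]) auto
    qed auto
    then obtain \<psi>s where \<psi>s: "map (eval A e) \<psi>s = xs" "list_all (wff (arity L)) \<psi>s" by blast
    then show ?thesis
      using c by (auto simp: S_def intro!: image_eqI[of _ _ "Op c \<psi>s"])
  qed
  have zz: "\<^bold>\<bottom>\<^bsub>A\<^esub> \<leadsto>\<^bsub>A\<^esub> \<^bold>\<bottom>\<^bsub>A\<^esub> = \<one>\<^bsub>A\<^esub>"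
  proof -
    have "\<one>\<^bsub>A\<^esub> \<preceq>\<^bsub>A\<^esub> (\<^bold>\<bottom>\<^bsub>A\<^esub> \<leadsto>\<^bsub>A\<^esub> \<^bold>\<bottom>\<^bsub>A\<^esub>)"
      using A.residuation[of "\<one>\<^bsub>A\<^esub>" "\<^bold>\<bottom>\<^bsub>A\<^esub>" "\<^bold>\<bottom>\<^bsub>A\<^esub>"] A.zer_below[of "\<^bold>\<bottom>\<^bsub>A\<^esub>"]
      by (simp add: A.zer_closed)
    then show ?thesis
      using A.below_one[of "\<^bold>\<bottom>\<^bsub>A\<^esub> \<leadsto>\<^bsub>A\<^esub> \<^bold>\<bottom>\<^bsub>A\<^esub>"] A.mt_comm[of "\<one>\<^bsub>A\<^esub>" "\<^bold>\<bottom>\<^bsub>A\<^esub> \<leadsto>\<^bsub>A\<^esub> \<^bold>\<bottom>\<^bsub>A\<^esub>"]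
      by (simp add: below_def A.zer_closed A.residuum_closed)
  qed
  have S_one: "\<one>\<^bsub>A\<^esub> \<in> S"
    using S_res[OF S_zer S_zer] by (simp add: zz)
  have S_jn: "x \<^bold>\<squnion>\<^bsub>A\<^esub> y \<in> S" if "x \<in> S" "y \<in> S" for x y
  proof -
    have "x \<preceq>\<^bsub>A\<^esub> y \<or> y \<preceq>\<^bsub>A\<^esub> x"
      using chain that SA by (auto simp: is_chain_def)
    then have "x \<^bold>\<squnion>\<^bsub>A\<^esub> y = x \<or> x \<^bold>\<squnion>\<^bsub>A\<^esub> y = y"
      using A.jn_absorb[of x y] A.jn_absorb[of y x] A.jn_comm[of x y] A.mt_comm[of x y] that SA
      by (auto simp: below_def)
    then show ?thesis using that by auto
  qed
  note S = S_mt S_mult S_res S_zer S_ops S_one S_jn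
  have B_below: "h x \<preceq>\<^bsub>B\<^esub> h y \<longleftrightarrow> x \<preceq>\<^bsub>A\<^esub> y" if "x \<in> S" "y \<in> S" for x y
    using that by (simp add: below_def B_def gh h_eq S)
  have "comm_monoid B"
    by unfold_locales (auto simp: B_def gh S SA A.m_ac)
  then interpret B: comm_monoid B .
  have "mtl_algebra B"
  proof unfold_locales
    fix x assume "x \<in> carrier B"
    then obtain u where u: "u \<in> S" "x = h u" by (auto simp: B_def)
    show "\<^bold>\<bottom>\<^bsub>B\<^esub> \<preceq>\<^bsub>B\<^esub> x"
      using u B_below[OF S_zer, of u] A.zer_below SA by (simp add: B_def)
    show "x \<preceq>\<^bsub>B\<^esub> \<one>\<^bsub>B\<^esub>"
      using u B_below[OF _ S_one, of u] A.below_one SA by (simp add: B_def)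
  next
    fix x y assume "x \<in> carrier B" "y \<in> carrier B"
    then have "g x \<in> carrier A" "g y \<in> carrier A" by (auto simp: B_def gh SA)
    then show "x \<^bold>\<sqinter>\<^bsub>B\<^esub> y = y \<^bold>\<sqinter>\<^bsub>B\<^esub> x" "x \<^bold>\<squnion>\<^bsub>B\<^esub> y = y \<^bold>\<squnion>\<^bsub>B\<^esub> x"
      by (simp_all add: B_def A.mt_comm[of "g x" "g y"] A.jn_comm[of "g x" "g y"])
  next
    fix x y z assume "x \<in> carrier B" "y \<in> carrier B" "z \<in> carrier B"
    then obtain u v w where uvw: "u \<in> S" "x = h u" "v \<in> S" "y = h v" "w \<in> S" "z = h w"
      by (auto simp: B_def)
    have "x \<otimes>\<^bsub>B\<^esub> y = h (u \<otimes>\<^bsub>A\<^esub> v)" "y \<leadsto>\<^bsub>B\<^esub> z = h (v \<leadsto>\<^bsub>A\<^esub> w)"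
      using uvw by (simp_all add: B_def gh)
    then show "(x \<otimes>\<^bsub>B\<^esub> y \<preceq>\<^bsub>B\<^esub> z) = (x \<preceq>\<^bsub>B\<^esub> y \<leadsto>\<^bsub>B\<^esub> z)"
      using uvw B_below S A.residuation SA by simp
  qed (auto simp: B_def gh S SA A.mt_assoc A.jn_assoc A.mt_absorb A.jn_absorb A.prelinear)
  have eval_B: "eval A (g \<circ> f) \<psi> \<in> S \<and> eval B f \<psi> = h (eval A (g \<circ> f) \<psi>)"
    if f: "evaluation B f" and \<psi>: "wff (arity L) \<psi>" for f \<psi>
    using \<psi>
  proof (induction \<psi>)
    case (Var n)
    have "f n \<in> h ` S" using f by (auto simp: B_def)
    then obtain u where "u \<in> S" "f n = h u" by blast
    then show ?case by (simp add: gh)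
  next
    case (Op c \<psi>s)
    then have IH: "\<And>\<psi>. \<psi> \<in> set \<psi>s \<Longrightarrow>
        eval A (g \<circ> f) \<psi> \<in> S \<and> eval B f \<psi> = h (eval A (g \<circ> f) \<psi>)"
      unfolding wff.simps list_all_iff by blast
    then have "map g (map (eval B f) \<psi>s) = map (eval A (g \<circ> f)) \<psi>s"
      by (simp add: gh)
    moreover have "eval B f (Op c \<psi>s) = h (ops A c (map g (map (eval B f) \<psi>s)))"
      by (simp add: B_def)
    moreover have "ops A c (map (eval A (g \<circ> f)) \<psi>s) \<in> S"
      using IH Op.prems by (intro S_ops) auto
    ultimately show ?case by (simp only: eval.simps)
  qed (simp_all add: B_def S gh)
  have gf: "evaluation A (g \<circ> f)" if "evaluation B f" for f
  proof -
    have "(g \<circ> f) n \<in> carrier A" for n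
      using eval_B[OF that, of "Var n"] SA by (simp del: comp_apply)
    then show ?thesis by blast
  qed
  have eval_B_one: "eval B f \<psi> = \<one>\<^bsub>B\<^esub> \<longleftrightarrow> eval A (g \<circ> f) \<psi> = \<one>\<^bsub>A\<^esub>"
    if "evaluation B f" "wff (arity L) \<psi>" for f \<psi>
  proof -
    have "\<one>\<^bsub>B\<^esub> = h \<one>\<^bsub>A\<^esub>" by (simp add: B_def)
    then show ?thesis using eval_B[OF that] h_eq[OF _ S_one] by metis
  qed
  have "is_algebra L B"
    unfolding is_algebra_def
  proof (intro conjI allI impI ballI)
    fix c n xs assume c: "arity L c = Some n" "length xs = n" and xs: "set xs \<subseteq> carrier B"
    have "set (map g xs) \<subseteq> S" using xs by (auto simp: B_def gh)
    then show "ops B c xs \<in> carrier B"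
      using c S_ops[of c "map g xs"] by (simp add: B_def)
  next
    fix f \<alpha> assume f: "evaluation B f" and \<alpha>: "\<alpha> \<in> axioms L"
    have "wff (arity L) \<alpha>" using L \<alpha> by (simp add: well_formed_logic_def)
    from eval_B_one[OF f this] A_axiom[OF gf[OF f] \<alpha>] show "eval B f \<alpha> = \<one>\<^bsub>B\<^esub>" by (rule iffD2)
  next
    fix f r assume f: "evaluation B f" and r: "r \<in> rules L"
    obtain P \<gamma> where r_eq: "r = (P, \<gamma>)" by (cases r)
    have wf: "\<And>\<pi>. \<pi> \<in> P \<Longrightarrow> wff (arity L) \<pi>" "wff (arity L) \<gamma>"
      using L r by (auto simp: well_formed_logic_def r_eq)
    have "eval B f \<gamma> = \<one>\<^bsub>B\<^esub>" if P: "\<forall>\<pi> \<in> P. eval B f \<pi> = \<one>\<^bsub>B\<^esub>"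
    proof (rule iffD2[OF eval_B_one[OF f wf(2)]], rule A_rule[OF gf[OF f] r[unfolded r_eq]])
      fix \<pi> assume \<pi>: "\<pi> \<in> P"
      from eval_B_one[OF f wf(1)[OF \<pi>]] bspec[OF P \<pi>] show "eval A (g \<circ> f) \<pi> = \<one>\<^bsub>A\<^esub>"
        by (rule iffD1)
    qed
    then show "case r of (P, \<gamma>) \<Rightarrow>
        (\<forall>\<pi> \<in> P. eval B f \<pi> = \<one>\<^bsub>B\<^esub>) \<longrightarrow> eval B f \<gamma> = \<one>\<^bsub>B\<^esub>"
      by (simp only: r_eq case_prod_conv) blast
  qed fact
  moreover have "x \<preceq>\<^bsub>B\<^esub> y \<or> y \<preceq>\<^bsub>B\<^esub> x" if xy: "x \<in> carrier B" "y \<in> carrier B" for x y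
  proof -
    obtain u v where "u \<in> S" "x = h u" "v \<in> S" "y = h v"
      using xy by (auto simp: B_def)
    then show ?thesis using B_below chain SA by (auto simp: is_chain_def)
  qed
  ultimately have chain_B: "is_chain L B" by (simp add: is_chain_def)
  have eS: "e n \<in> S" for n
    by (auto simp: S_def intro!: image_eqI[of _ _ "Var n"])
  have f: "evaluation B (h \<circ> e)" using eS by (auto simp: B_def)
  have ghe: "g \<circ> (h \<circ> e) = e" using eS by (auto simp: gh)
  have "\<forall>\<gamma> \<in> \<Gamma>. eval B (h \<circ> e) \<gamma> = \<one>\<^bsub>B\<^esub>"
    using prem \<Gamma> eval_B_one[OF f, unfolded ghe] by simp
  then have "eval B (h \<circ> e) \<phi> = \<one>\<^bsub>B\<^esub>"
    using cons chain_B f unfolding chain_consequence_def by blast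
  then show "eval A e \<phi> = \<one>\<^bsub>A\<^esub>"
    using eval_B_one[OF f \<phi>, unfolded ghe] by simp
qed


section \<open>The logics with a consistency operator\<close>

datatype 'c circ = Old 'c | Circ

abbreviation circ_fm :: "'c circ fm \<Rightarrow> 'c circ fm"  (\<open>\<^bold>\<circ> _\<close> [80] 80)
  where "\<^bold>\<circ> \<phi> \<equiv> Op Circ [\<phi>]"

text \<open>The schemata of \<open>L\<close> are kept, but read in the expanded language: \<open>derives\<close> instantiates them
  with arbitrary formulas of the language with \<open>\<circ>\<close>.\<close>

definition circ_logic :: "'c logic \<Rightarrow> 'c circ logic" where
  "circ_logic L = (let \<phi> = Var 0; \<psi> = Var 1; \<delta> = Var 2 in
     \<lparr>arity = (\<lambda>c. case c of Old d \<Rightarrow> arity L d | Circ \<Rightarrow> Some 1),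
      axioms = map_fm Old ` axioms L \<union>
        {\<^bold>\<not> (\<phi> \<^bold>\<and> \<^bold>\<not> \<phi> \<^bold>\<and> \<^bold>\<circ> \<phi>), \<^bold>\<circ> \<^bold>1, \<^bold>\<circ> \<^bold>0},
      rules = (\<lambda>(P, \<gamma>). (map_fm Old ` P, map_fm Old \<gamma>)) ` rules L \<union>
        {({(\<phi> \<^bold>\<leftrightarrow> \<psi>) \<^bold>\<or> \<delta>}, (\<^bold>\<circ> \<phi> \<^bold>\<leftrightarrow> \<^bold>\<circ> \<psi>) \<^bold>\<or> \<delta>),
         ({(\<^bold>\<not> \<^bold>\<not> \<phi> \<^bold>\<and> (\<phi> \<^bold>\<rightarrow> \<psi>)) \<^bold>\<or> \<delta>}, (\<^bold>\<circ> \<phi> \<^bold>\<rightarrow> \<^bold>\<circ> \<psi>) \<^bold>\<or> \<delta>)}\<rparr>)"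

definition dat_logic :: "'c logic \<Rightarrow> 'c circ logic" where
  "dat_logic L = (circ_logic L)
     \<lparr>axioms := insert (\<^bold>\<circ> (Var 0) \<^bold>\<rightarrow> Var 0 \<^bold>\<or> \<^bold>\<not> (Var 0)) (axioms (circ_logic L))\<rparr>"

end

theory Submission
  imports Defs
begin

text \<open>The link between the two logics is excluded middle for variables. In MTL extended by the
  hypotheses \<open>p \<or> \<not> p\<close>, one for each variable of \<open>\<phi>\<close>, every classical tautology \<open>\<phi>\<close> is derivable
  (\<open>tautology_from_excluded_middle\<close>). This is Kalmar's argument: once every variable is
  decided, MTL alone decides every formula according to its truth table (\<open>mtl_decides\<close>), and the
  \<open>2\<^sup>n\<close> ways of deciding the variables are merged by reasoning by cases (\<open>mtl_cases\<close>). MTL has no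
  contraction, so its deduction theorem is too weak for the usual proof of the latter; what carries
  it is that modus ponens stays valid when a common disjunct is attached to both premises and the
  conclusion.

  If \<open>\<phi>\<close> is a classical theorem, it is a tautology. The axiom \<open>\<circ>p \<rightarrow> p \<or> \<not> p\<close> supplies
  the hypotheses from the conjunction \<open>D\<close> of the \<open>\<circ>p\<close>, and the local deduction theorem of MTL
  turns the resulting derivation of \<open>\<phi>\<close> from \<open>D\<close> into a proof of \<open>D\<^sup>k \<rightarrow> \<phi>\<close>, where \<open>k\<close> bounds
  the number of uses of \<open>D\<close>.

  Conversely, a semilinear logic that is not SMTL has a chain with \<open>0 \<noteq> 1\<close>. On it the operation that
  is \<open>1\<close> at \<open>0\<close> and \<open>1\<close> and is \<open>0\<close> elsewhere satisfies all axioms and rules for \<open>\<circ>\<close>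
  (\<open>circ_algebra_of_chain\<close>). Evaluated at \<open>0\<close> and \<open>1\<close>, the powers of \<open>D\<close> have value \<open>1\<close> and \<open>\<phi>\<close>
  behaves classically, so provability of \<open>D\<^sup>k \<rightarrow> \<phi>\<close> makes \<open>\<phi>\<close> a tautology. The same result about
  excluded middle then yields a classical proof, as classical logic proves excluded middle and the
  axioms of MTL.\<close>

section \<open>Classical truth\<close>

text \<open>Connectives foreign to classical logic get a fixed value, so that truth commutes with
  substitution for all formulas.\<close>

primrec truth :: "(nat \<Rightarrow> bool) \<Rightarrow> 'c fm \<Rightarrow> bool" where
  "truth v (Var n) \<longleftrightarrow> v n"
| "truth v \<^bold>0 \<longleftrightarrow> False"
| "truth v (\<phi> \<^bold>\<and> \<psi>) \<longleftrightarrow> truth v \<phi> \<and> truth v \<psi>"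
| "truth v (\<phi> \<^bold>& \<psi>) \<longleftrightarrow> truth v \<phi> \<and> truth v \<psi>"
| "truth v (\<phi> \<^bold>\<rightarrow> \<psi>) \<longleftrightarrow> (truth v \<phi> \<longrightarrow> truth v \<psi>)"
| "truth v (Op c \<phi>s) \<longleftrightarrow> False"

lemma truth_subst: "truth v (subst \<sigma> \<phi>) = truth (\<lambda>n. truth v (\<sigma> n)) \<phi>"
  by (induction \<phi>) auto

lemma cpl_sound:
  assumes "\<turnstile>\<^bsub>cpl\<^esub> \<phi>"
  shows "truth v \<phi>"
  using assms
proof induction
  case (axiom_instance \<alpha> \<sigma>)
  then show ?case by (auto simp: cpl_def Let_def truth_subst)
next
  case (rule_instance P \<gamma> \<sigma>)
  then have "P = {Var 0, Var 0 \<^bold>\<rightarrow> Var 1}" "\<gamma> = Var 1"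
    by (auto simp: cpl_def modus_ponens_def)
  then show ?case
    using rule_instance.IH[of "Var 0"] rule_instance.IH[of "Var 0 \<^bold>\<rightarrow> Var 1"] by simp
qed simp


section \<open>Derivations\<close>

lemma wff_subst:
  assumes "\<And>n. wff ar (\<sigma> n)" and "wff ar \<phi>"
  shows "wff ar (subst \<sigma> \<phi>)"
  using assms(2) by (induction \<phi>) (auto simp: assms(1) list_all_iff)

lemma wff_extend_language: "wff Map.empty \<phi> \<Longrightarrow> wff ar \<phi>"
  by (induction \<phi>) auto

lemma finite_vars [simp]: "finite (vars \<phi>)"
  by (induction \<phi>) auto

lemma derives_cut:
  assumes "derives L \<Gamma> \<phi>" and "\<And>\<gamma>. \<lbrakk>\<gamma> \<in> \<Gamma>; wff (arity L) \<gamma>\<rbrakk> \<Longrightarrow> derives L \<Delta> \<gamma>"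
  shows "derives L \<Delta> \<phi>"
  using assms(1) by induction (auto intro: assms(2) derives.intros)

abbreviation metavars :: "'c fm \<Rightarrow> 'c fm \<Rightarrow> 'c fm \<Rightarrow> nat \<Rightarrow> 'c fm" where
  "metavars \<phi> \<psi> \<chi> n \<equiv> if n = 0 then \<phi> else if n = 1 then \<psi> else \<chi>"

lemma derives_axiom:
  assumes "\<alpha> \<in> axioms L" "wff (arity L) \<phi>" "wff (arity L) \<psi>" "wff (arity L) \<chi>"
  shows "derives L \<Gamma> (subst (metavars \<phi> \<psi> \<chi>) \<alpha>)"
  using assms by (intro derives.axiom_instance) auto

lemma derives_mp:
  assumes "modus_ponens \<in> rules L" and wff: "wff (arity L) \<phi>" "wff (arity L) \<psi>"
    and prem: "derives L \<Gamma> (\<phi> \<^bold>\<rightarrow> \<psi>)" "derives L \<Gamma> \<phi>"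
  shows "derives L \<Gamma> \<psi>"
proof -
  have "derives L \<Gamma> (subst (metavars \<phi> \<psi> \<psi>) (Var 1))"
  proof (rule derives.rule_instance)
    show "({Var 0, Var 0 \<^bold>\<rightarrow> Var 1}, Var 1) \<in> rules L"
      using assms(1) by (simp only: modus_ponens_def)
  qed (use wff prem in auto)
  then show ?thesis by simp
qed

text \<open>Deduction theorems and proof by cases are inductions on derivations in a
  calculus whose sole rule is modus ponens.\<close>

lemma modus_ponens_induct [consumes 3, case_names hypothesis axiom_instance mp]:
  assumes "derives L \<Gamma> \<phi>" and "rules L = {modus_ponens}"
    and "\<And>\<alpha>. \<alpha> \<in> axioms L \<Longrightarrow> wff (arity L) \<alpha>"
    and "\<And>\<phi>. \<lbrakk>\<phi> \<in> \<Gamma>; wff (arity L) \<phi>\<rbrakk> \<Longrightarrow> P \<phi>"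
    and "\<And>\<alpha> \<sigma>. \<lbrakk>\<alpha> \<in> axioms L; \<And>n. wff (arity L) (\<sigma> n); wff (arity L) (subst \<sigma> \<alpha>)\<rbrakk>
      \<Longrightarrow> P (subst \<sigma> \<alpha>)"
    and "\<And>\<phi> \<psi>. \<lbrakk>wff (arity L) \<phi>; wff (arity L) \<psi>; P \<phi>; P (\<phi> \<^bold>\<rightarrow> \<psi>)\<rbrakk> \<Longrightarrow> P \<psi>"
  shows "P \<phi>"
proof -
  have "wff (arity L) \<phi> \<and> P \<phi>"
    using assms(1)
  proof induction
    case (axiom_instance \<alpha> \<sigma>)
    then show ?case using assms(3,5) wff_subst by blast
  next
    case (rule_instance R \<gamma> \<sigma>)
    then have "R = {Var 0, Var 0 \<^bold>\<rightarrow> Var 1}" "\<gamma> = Var 1"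
      by (auto simp: assms(2) modus_ponens_def)
    then show ?case
      using rule_instance.IH[of "Var 0"] rule_instance.IH[of "Var 0 \<^bold>\<rightarrow> Var 1"] assms(6) by auto
  qed (simp add: assms(4))
  then show ?thesis by blast
qed


section \<open>Derivations in MTL\<close>

definition mtl :: "('c \<rightharpoonup> nat) \<Rightarrow> 'c logic" where
  "mtl ar = \<lparr>arity = ar, axioms = mtl_axioms, rules = {modus_ponens}\<rparr>"

lemma mtl_simps [simp]:
  "arity (mtl ar) = ar" "axioms (mtl ar) = mtl_axioms" "rules (mtl ar) = {modus_ponens}"
  by (simp_all add: mtl_def)

lemma wff_mtl_axioms: "\<alpha> \<in> mtl_axioms \<Longrightarrow> wff ar \<alpha>"
  by (auto simp: mtl_axioms_def Let_def)

lemma mtl_induct [consumes 1, case_names hypothesis axiom_instance mp]: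
  assumes "derives (mtl ar) \<Gamma> \<phi>"
    and "\<And>\<phi>. \<lbrakk>\<phi> \<in> \<Gamma>; wff ar \<phi>\<rbrakk> \<Longrightarrow> P \<phi>"
    and "\<And>\<alpha> \<sigma>. \<lbrakk>\<alpha> \<in> mtl_axioms; \<And>n. wff ar (\<sigma> n); wff ar (subst \<sigma> \<alpha>)\<rbrakk> \<Longrightarrow> P (subst \<sigma> \<alpha>)"
    and "\<And>\<phi> \<psi>. \<lbrakk>wff ar \<phi>; wff ar \<psi>; P \<phi>; P (\<phi> \<^bold>\<rightarrow> \<psi>)\<rbrakk> \<Longrightarrow> P \<psi>"
  shows "P \<phi>"
  by (rule modus_ponens_induct[OF assms(1)]) (simp_all add: wff_mtl_axioms assms(2,3), fact assms(4))

lemma mtl_wff: "derives (mtl ar) \<Gamma> \<phi> \<Longrightarrow> wff ar \<phi>"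
  by (induction rule: mtl_induct) auto

text \<open>A logic simulates MTL derivations as soon as it has modus ponens and proves the axiom
  instances; the axioms themselves may be derived, as they are in \<open>cpl\<close>.\<close>

lemma mtl_embed:
  assumes "derives (mtl (arity L)) \<Gamma> \<phi>" and "modus_ponens \<in> rules L"
    and "\<And>\<alpha> \<sigma>. \<lbrakk>\<alpha> \<in> mtl_axioms; \<And>n. wff (arity L) (\<sigma> n)\<rbrakk> \<Longrightarrow> derives L \<Gamma> (subst \<sigma> \<alpha>)"
  shows "derives L \<Gamma> \<phi>"
  using assms(1) by (induction rule: mtl_induct) (auto intro: assms derives.hypothesis derives_mp)

context
  fixes ar :: "'c \<rightharpoonup> nat" and \<Gamma> :: "'c fm set"
begin

abbreviation mtl_prv :: "'c fm \<Rightarrow> bool" (\<open>\<tturnstile> _\<close> [60] 60) where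
  "\<tturnstile> \<phi> \<equiv> derives (mtl ar) \<Gamma> \<phi>"

lemma mtl_mp: "\<lbrakk>\<tturnstile> \<phi> \<^bold>\<rightarrow> \<psi>; \<tturnstile> \<phi>\<rbrakk> \<Longrightarrow> \<tturnstile> \<psi>"
  using derives_mp[of "mtl ar" \<phi> \<psi>] mtl_wff[of ar \<Gamma> "\<phi> \<^bold>\<rightarrow> \<psi>"] by auto

lemma mtl_axiom_instances:
  assumes "wff ar \<phi>" "wff ar \<psi>" "wff ar \<chi>"
  shows "\<forall>\<alpha> \<in> mtl_axioms. \<tturnstile> subst (metavars \<phi> \<psi> \<chi>) \<alpha>"
  using derives_axiom[of _ "mtl ar" \<phi> \<psi> \<chi> \<Gamma>] assms by simp

lemma mtl_axiom_schemata:
  assumes [simp]: "wff ar \<phi>" "wff ar \<psi>" "wff ar \<chi>"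
  shows "\<tturnstile> (\<phi> \<^bold>\<rightarrow> \<psi>) \<^bold>\<rightarrow> (\<psi> \<^bold>\<rightarrow> \<chi>) \<^bold>\<rightarrow> \<phi> \<^bold>\<rightarrow> \<chi>"
    and "\<tturnstile> \<phi> \<^bold>& \<psi> \<^bold>\<rightarrow> \<phi>"
    and "\<tturnstile> \<phi> \<^bold>& \<psi> \<^bold>\<rightarrow> \<psi> \<^bold>& \<phi>"
    and "\<tturnstile> \<phi> \<^bold>\<and> \<psi> \<^bold>\<rightarrow> \<phi>"
    and "\<tturnstile> \<phi> \<^bold>\<and> \<psi> \<^bold>\<rightarrow> \<psi> \<^bold>\<and> \<phi>"
    and "\<tturnstile> \<phi> \<^bold>& (\<phi> \<^bold>\<rightarrow> \<psi>) \<^bold>\<rightarrow> \<phi> \<^bold>\<and> \<psi>"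
    and "\<tturnstile> (\<phi> \<^bold>\<rightarrow> \<psi> \<^bold>\<rightarrow> \<chi>) \<^bold>\<rightarrow> \<phi> \<^bold>& \<psi> \<^bold>\<rightarrow> \<chi>"
    and "\<tturnstile> (\<phi> \<^bold>& \<psi> \<^bold>\<rightarrow> \<chi>) \<^bold>\<rightarrow> \<phi> \<^bold>\<rightarrow> \<psi> \<^bold>\<rightarrow> \<chi>"
    and "\<tturnstile> ((\<phi> \<^bold>\<rightarrow> \<psi>) \<^bold>\<rightarrow> \<chi>) \<^bold>\<rightarrow> ((\<psi> \<^bold>\<rightarrow> \<phi>) \<^bold>\<rightarrow> \<chi>) \<^bold>\<rightarrow> \<chi>"
    and "\<tturnstile> \<^bold>0 \<^bold>\<rightarrow> \<phi>"
  using mtl_axiom_instances[OF assms, unfolded mtl_axioms_def Let_def, simplified] by blast+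

lemma mtl_trans:
  assumes "\<tturnstile> \<phi> \<^bold>\<rightarrow> \<psi>" "\<tturnstile> \<psi> \<^bold>\<rightarrow> \<chi>"
  shows "\<tturnstile> \<phi> \<^bold>\<rightarrow> \<chi>"
  using assms mtl_wff[OF assms(1)] mtl_wff[OF assms(2)]
  by (auto intro: mtl_mp mtl_axiom_schemata(1))

lemma mtl_uncurry: "\<tturnstile> \<phi> \<^bold>\<rightarrow> \<psi> \<^bold>\<rightarrow> \<chi> \<Longrightarrow> \<tturnstile> \<phi> \<^bold>& \<psi> \<^bold>\<rightarrow> \<chi>"
  using mtl_wff[of ar \<Gamma> "\<phi> \<^bold>\<rightarrow> \<psi> \<^bold>\<rightarrow> \<chi>"] by (auto intro: mtl_mp mtl_axiom_schemata(7))

lemma mtl_curry: "\<tturnstile> \<phi> \<^bold>& \<psi> \<^bold>\<rightarrow> \<chi> \<Longrightarrow> \<tturnstile> \<phi> \<^bold>\<rightarrow> \<psi> \<^bold>\<rightarrow> \<chi>"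
  using mtl_wff[of ar \<Gamma> "\<phi> \<^bold>& \<psi> \<^bold>\<rightarrow> \<chi>"] by (auto intro: mtl_mp mtl_axiom_schemata(8))

lemma mtl_exchange:
  assumes "\<tturnstile> \<phi> \<^bold>\<rightarrow> \<psi> \<^bold>\<rightarrow> \<chi>"
  shows "\<tturnstile> \<psi> \<^bold>\<rightarrow> \<phi> \<^bold>\<rightarrow> \<chi>"
proof -
  have "\<tturnstile> \<psi> \<^bold>& \<phi> \<^bold>\<rightarrow> \<phi> \<^bold>& \<psi>"
    using mtl_wff[OF assms] by (auto intro: mtl_axiom_schemata(3)[where \<chi> = "\<^bold>0"])
  then show ?thesis using mtl_uncurry[OF assms] mtl_trans mtl_curry by blast
qed

lemma mtl_weaken: "\<lbrakk>wff ar \<phi>; wff ar \<psi>\<rbrakk> \<Longrightarrow> \<tturnstile> \<phi> \<^bold>\<rightarrow> \<psi> \<^bold>\<rightarrow> \<phi>"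
  by (rule mtl_curry) (auto intro: mtl_axiom_schemata(2)[where \<chi> = "\<^bold>0"])

text \<open>Identity is not among the axioms: exchanging the premises of \<open>\<phi> \<rightarrow> ((0 \<rightarrow> \<phi>) \<rightarrow> \<phi>)\<close> leaves
  \<open>\<phi> \<rightarrow> \<phi>\<close> behind the theorem \<open>0 \<rightarrow> \<phi>\<close>.\<close>

lemma mtl_refl:
  assumes "wff ar \<phi>"
  shows "\<tturnstile> \<phi> \<^bold>\<rightarrow> \<phi>"
proof -
  have "\<tturnstile> \<^bold>0 \<^bold>\<rightarrow> \<phi>" using assms by (auto intro: mtl_axiom_schemata(10)[where \<chi> = "\<^bold>0" and \<psi> = "\<^bold>0"])
  moreover have "\<tturnstile> (\<^bold>0 \<^bold>\<rightarrow> \<phi>) \<^bold>\<rightarrow> \<phi> \<^bold>\<rightarrow> \<phi>"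
    using mtl_exchange[OF mtl_weaken] assms by auto
  ultimately show ?thesis using mtl_mp by blast
qed

lemma mtl_const: "\<lbrakk>\<tturnstile> \<phi>; wff ar \<psi>\<rbrakk> \<Longrightarrow> \<tturnstile> \<psi> \<^bold>\<rightarrow> \<phi>"
  using mtl_mp[OF mtl_weaken] mtl_wff by blast

lemma mtl_assertion: "\<lbrakk>wff ar \<phi>; wff ar \<psi>\<rbrakk> \<Longrightarrow> \<tturnstile> \<phi> \<^bold>\<rightarrow> (\<phi> \<^bold>\<rightarrow> \<psi>) \<^bold>\<rightarrow> \<psi>"
  using mtl_exchange[OF mtl_refl] by auto

lemma mtl_prefix:
  assumes "\<tturnstile> \<psi> \<^bold>\<rightarrow> \<chi>" "wff ar \<phi>"
  shows "\<tturnstile> (\<phi> \<^bold>\<rightarrow> \<psi>) \<^bold>\<rightarrow> \<phi> \<^bold>\<rightarrow> \<chi>"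
  using assms mtl_wff[OF assms(1)] mtl_mp[OF mtl_exchange[OF mtl_axiom_schemata(1)]] by auto

lemma mtl_suffix:
  assumes "\<tturnstile> \<phi> \<^bold>\<rightarrow> \<psi>" "wff ar \<chi>"
  shows "\<tturnstile> (\<psi> \<^bold>\<rightarrow> \<chi>) \<^bold>\<rightarrow> \<phi> \<^bold>\<rightarrow> \<chi>"
  using assms mtl_wff[OF assms(1)] mtl_mp[OF mtl_axiom_schemata(1)] by auto

lemma mtl_prelinear:
  assumes "\<tturnstile> (\<phi> \<^bold>\<rightarrow> \<psi>) \<^bold>\<rightarrow> \<chi>" "\<tturnstile> (\<psi> \<^bold>\<rightarrow> \<phi>) \<^bold>\<rightarrow> \<chi>"
  shows "\<tturnstile> \<chi>"
  using mtl_wff[OF assms(1)] mtl_mp[OF mtl_mp[OF mtl_axiom_schemata(9) assms(1)] assms(2)] by auto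

lemma mtl_meet_left: "\<lbrakk>wff ar \<phi>; wff ar \<psi>\<rbrakk> \<Longrightarrow> \<tturnstile> \<phi> \<^bold>\<and> \<psi> \<^bold>\<rightarrow> \<phi>"
  by (rule mtl_axiom_schemata(4)[where \<chi> = "\<^bold>0"]) auto

lemma mtl_meet_commute: "\<lbrakk>wff ar \<phi>; wff ar \<psi>\<rbrakk> \<Longrightarrow> \<tturnstile> \<phi> \<^bold>\<and> \<psi> \<^bold>\<rightarrow> \<psi> \<^bold>\<and> \<phi>"
  by (rule mtl_axiom_schemata(5)[where \<chi> = "\<^bold>0"]) auto

lemma mtl_meet_right: "\<lbrakk>wff ar \<phi>; wff ar \<psi>\<rbrakk> \<Longrightarrow> \<tturnstile> \<phi> \<^bold>\<and> \<psi> \<^bold>\<rightarrow> \<psi>"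
  using mtl_trans[OF mtl_meet_commute mtl_meet_left] by blast

text \<open>The axioms introduce a meet only in \<open>\<phi> & (\<phi> \<rightarrow> \<psi>) \<rightarrow> \<phi> \<and> \<psi>\<close>. If \<open>\<phi> \<rightarrow> \<psi>\<close> holds, \<open>\<phi>\<close> is
  therefore below \<open>\<phi> \<and> \<psi>\<close>, otherwise \<open>\<psi>\<close> is by symmetry; prelinearity combines both cases.\<close>

lemma mtl_meet_greatest:
  assumes \<phi>: "\<tturnstile> \<chi> \<^bold>\<rightarrow> \<phi>" and \<psi>: "\<tturnstile> \<chi> \<^bold>\<rightarrow> \<psi>"
  shows "\<tturnstile> \<chi> \<^bold>\<rightarrow> \<phi> \<^bold>\<and> \<psi>"
proof (rule mtl_prelinear)
  have wff: "wff ar \<chi>" "wff ar \<phi>" "wff ar \<psi>" using mtl_wff[OF \<phi>] mtl_wff[OF \<psi>] by auto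
  have *: "\<tturnstile> (\<alpha> \<^bold>\<rightarrow> \<beta>) \<^bold>\<rightarrow> \<alpha> \<^bold>\<rightarrow> \<alpha> \<^bold>\<and> \<beta>" if "wff ar \<alpha>" "wff ar \<beta>" for \<alpha> \<beta>
    using that by (intro mtl_exchange[OF mtl_curry[OF mtl_axiom_schemata(6)[where \<chi> = "\<^bold>0"]]]) auto
  show "\<tturnstile> (\<phi> \<^bold>\<rightarrow> \<psi>) \<^bold>\<rightarrow> \<chi> \<^bold>\<rightarrow> \<phi> \<^bold>\<and> \<psi>"
    using mtl_trans[OF * mtl_suffix[OF \<phi>]] wff by simp
  have "\<tturnstile> (\<psi> \<^bold>\<rightarrow> \<phi>) \<^bold>\<rightarrow> \<chi> \<^bold>\<rightarrow> \<psi> \<^bold>\<and> \<phi>"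
    using mtl_trans[OF * mtl_suffix[OF \<psi>]] wff by simp
  then show "\<tturnstile> (\<psi> \<^bold>\<rightarrow> \<phi>) \<^bold>\<rightarrow> \<chi> \<^bold>\<rightarrow> \<phi> \<^bold>\<and> \<psi>"
    using mtl_trans[OF _ mtl_prefix[OF mtl_meet_commute]] wff by blast
qed

lemma mtl_join_left:
  assumes "wff ar \<phi>" "wff ar \<psi>"
  shows "\<tturnstile> \<phi> \<^bold>\<rightarrow> \<phi> \<^bold>\<or> \<psi>"
  using assms by (intro mtl_meet_greatest mtl_assertion mtl_weaken) auto

lemma mtl_join_right:
  assumes "wff ar \<phi>" "wff ar \<psi>"
  shows "\<tturnstile> \<psi> \<^bold>\<rightarrow> \<phi> \<^bold>\<or> \<psi>"
  using assms by (intro mtl_meet_greatest mtl_assertion mtl_weaken) auto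

text \<open>Again by prelinearity: under \<open>\<phi> \<rightarrow> \<psi>\<close> the first half of the defining formula of \<open>\<phi> \<or> \<psi>\<close>
  yields \<open>\<psi>\<close>, and under \<open>\<psi> \<rightarrow> \<phi>\<close> the second half yields \<open>\<phi>\<close>.\<close>

lemma mtl_join_least:
  assumes \<phi>: "\<tturnstile> \<phi> \<^bold>\<rightarrow> \<chi>" and \<psi>: "\<tturnstile> \<psi> \<^bold>\<rightarrow> \<chi>"
  shows "\<tturnstile> \<phi> \<^bold>\<or> \<psi> \<^bold>\<rightarrow> \<chi>"
proof (rule mtl_prelinear)
  have wff: "wff ar \<chi>" "wff ar \<phi>" "wff ar \<psi>" using mtl_wff[OF \<phi>] mtl_wff[OF \<psi>] by auto
  show "\<tturnstile> (\<phi> \<^bold>\<rightarrow> \<psi>) \<^bold>\<rightarrow> \<phi> \<^bold>\<or> \<psi> \<^bold>\<rightarrow> \<chi>"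
    by (rule mtl_exchange, rule mtl_trans[OF mtl_meet_left], use wff in auto)
      (rule mtl_prefix[OF \<psi>], use wff in auto)
  show "\<tturnstile> (\<psi> \<^bold>\<rightarrow> \<phi>) \<^bold>\<rightarrow> \<phi> \<^bold>\<or> \<psi> \<^bold>\<rightarrow> \<chi>"
    by (rule mtl_exchange, rule mtl_trans[OF mtl_meet_right], use wff in auto)
      (rule mtl_prefix[OF \<phi>], use wff in auto)
qed

text \<open>Modus ponens with a side disjunct. It makes derivations stable under adding a disjunct
  throughout, which replaces the full deduction theorem in proofs by cases.\<close>

lemma mtl_mp_join:
  assumes \<phi>: "\<tturnstile> \<phi> \<^bold>\<or> \<delta>" and imp: "\<tturnstile> (\<phi> \<^bold>\<rightarrow> \<psi>) \<^bold>\<or> \<delta>"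
  shows "\<tturnstile> \<psi> \<^bold>\<or> \<delta>"
proof -
  have wff: "wff ar \<phi>" "wff ar \<psi>" "wff ar \<delta>" using mtl_wff[OF imp] by auto
  have \<psi>: "\<tturnstile> \<psi> \<^bold>\<rightarrow> \<psi> \<^bold>\<or> \<delta>" and \<delta>: "\<tturnstile> \<delta> \<^bold>\<rightarrow> \<psi> \<^bold>\<or> \<delta>"
    using wff mtl_join_left mtl_join_right by auto
  have "\<tturnstile> \<phi> \<^bold>\<or> \<delta> \<^bold>\<rightarrow> (\<phi> \<^bold>\<rightarrow> \<psi>) \<^bold>\<rightarrow> \<psi> \<^bold>\<or> \<delta>"
  proof (rule mtl_join_least)
    show "\<tturnstile> \<phi> \<^bold>\<rightarrow> (\<phi> \<^bold>\<rightarrow> \<psi>) \<^bold>\<rightarrow> \<psi> \<^bold>\<or> \<delta>"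
      using mtl_trans[OF mtl_assertion mtl_prefix[OF \<psi>]] wff by simp
    show "\<tturnstile> \<delta> \<^bold>\<rightarrow> (\<phi> \<^bold>\<rightarrow> \<psi>) \<^bold>\<rightarrow> \<psi> \<^bold>\<or> \<delta>"
      using mtl_trans[OF \<delta> mtl_weaken] wff by simp
  qed
  with \<phi> have "\<tturnstile> (\<phi> \<^bold>\<rightarrow> \<psi>) \<^bold>\<rightarrow> \<psi> \<^bold>\<or> \<delta>" by (rule mtl_mp[rotated])
  then have "\<tturnstile> (\<phi> \<^bold>\<rightarrow> \<psi>) \<^bold>\<or> \<delta> \<^bold>\<rightarrow> \<psi> \<^bold>\<or> \<delta>" using \<delta> by (rule mtl_join_least)
  then show ?thesis using imp by (rule mtl_mp)
qed

lemma mtl_meetI: "\<lbrakk>\<tturnstile> \<phi>; \<tturnstile> \<psi>\<rbrakk> \<Longrightarrow> \<tturnstile> \<phi> \<^bold>\<and> \<psi>"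
  by (rule mtl_mp[OF mtl_meet_greatest, of \<phi>]) (auto intro: mtl_refl mtl_const mtl_wff)

lemma mtl_fuseI: "\<lbrakk>\<tturnstile> \<phi>; \<tturnstile> \<psi>\<rbrakk> \<Longrightarrow> \<tturnstile> \<phi> \<^bold>& \<psi>"
  by (rule mtl_mp[OF mtl_mp[OF mtl_curry[OF mtl_refl]]]) (auto dest: mtl_wff)

lemma mtl_fuse_right: "\<lbrakk>wff ar \<phi>; wff ar \<psi>\<rbrakk> \<Longrightarrow> \<tturnstile> \<phi> \<^bold>& \<psi> \<^bold>\<rightarrow> \<psi>"
  by (rule mtl_uncurry, rule mtl_const, rule mtl_refl)

lemma mtl_fuse_left: "\<lbrakk>wff ar \<phi>; wff ar \<psi>\<rbrakk> \<Longrightarrow> \<tturnstile> \<phi> \<^bold>& \<psi> \<^bold>\<rightarrow> \<phi>"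
  by (rule mtl_uncurry, rule mtl_weaken)

lemma mtl_join_idem:
  assumes "\<tturnstile> \<phi> \<^bold>\<or> \<phi>"
  shows "\<tturnstile> \<phi>"
  using mtl_mp[OF mtl_join_least[OF mtl_refl mtl_refl] assms] mtl_wff[OF assms] by simp

lemma mtl_join_commute:
  assumes "\<tturnstile> \<phi> \<^bold>\<or> \<psi>"
  shows "\<tturnstile> \<psi> \<^bold>\<or> \<phi>"
  using mtl_mp[OF mtl_join_least[OF mtl_join_right mtl_join_left] assms] mtl_wff[OF assms] by simp

lemma mtl_big_and:
  assumes "\<phi> \<in> set \<phi>s" "\<forall>\<phi> \<in> set \<phi>s. wff ar \<phi>"
  shows "\<tturnstile> big_and \<phi>s \<^bold>\<rightarrow> \<phi>"
  using assms
proof (induction \<phi>s rule: big_and.induct)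
  case (3 \<alpha> \<beta> \<phi>s)
  have wff: "wff ar \<alpha>" "wff ar (big_and (\<beta> # \<phi>s))"
  proof -
    have "\<forall>\<phi> \<in> set \<phi>s. wff ar \<phi> \<Longrightarrow> wff ar (big_and \<phi>s)" for \<phi>s
      by (induction \<phi>s rule: big_and.induct) auto
    then show "wff ar \<alpha>" "wff ar (big_and (\<beta> # \<phi>s))" using 3 by auto
  qed
  show ?case
    using 3 mtl_meet_left[OF wff] mtl_trans[OF mtl_meet_right[OF wff]] by auto
qed (auto intro: mtl_refl)

text \<open>Moving the factors of \<open>\<alpha>\<close> from the second power to the first one at a time keeps
  associativity of \<open>&\<close> out of the argument.\<close>

lemma mtl_fpow_add:
  assumes "\<tturnstile> fpow \<alpha> k \<^bold>\<rightarrow> fpow \<alpha> (Suc m) \<^bold>\<rightarrow> \<chi>" and "k \<ge> 1"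
  shows "\<tturnstile> fpow \<alpha> (k + Suc m) \<^bold>\<rightarrow> \<chi>"
  using assms
proof (induction m arbitrary: \<chi>)
  case 0
  then show ?case using mtl_uncurry by (cases k) auto
next
  case (Suc m)
  then have wff: "wff ar (fpow \<alpha> k)" "wff ar (fpow \<alpha> (Suc m))" "wff ar \<alpha>" "wff ar \<chi>"
    using mtl_wff[OF Suc.prems(1)] by auto
  have "\<tturnstile> fpow \<alpha> (Suc (Suc m)) \<^bold>\<rightarrow> fpow \<alpha> k \<^bold>\<rightarrow> \<chi>"
    using Suc.prems(1) by (rule mtl_exchange)
  then have "\<tturnstile> fpow \<alpha> (Suc m) \<^bold>\<rightarrow> \<alpha> \<^bold>\<rightarrow> fpow \<alpha> k \<^bold>\<rightarrow> \<chi>"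
    by (auto intro: mtl_curry)
  moreover have "\<tturnstile> (\<alpha> \<^bold>\<rightarrow> fpow \<alpha> k \<^bold>\<rightarrow> \<chi>) \<^bold>\<rightarrow> fpow \<alpha> k \<^bold>\<rightarrow> \<alpha> \<^bold>\<rightarrow> \<chi>"
  proof (rule mtl_exchange, rule mtl_trans)
    show "\<tturnstile> fpow \<alpha> k \<^bold>\<rightarrow> (fpow \<alpha> k \<^bold>\<rightarrow> \<chi>) \<^bold>\<rightarrow> \<chi>" using wff by (intro mtl_assertion)
    show "\<tturnstile> ((fpow \<alpha> k \<^bold>\<rightarrow> \<chi>) \<^bold>\<rightarrow> \<chi>) \<^bold>\<rightarrow> (\<alpha> \<^bold>\<rightarrow> fpow \<alpha> k \<^bold>\<rightarrow> \<chi>) \<^bold>\<rightarrow> \<alpha> \<^bold>\<rightarrow> \<chi>"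
      using wff by (intro mtl_exchange[OF mtl_axiom_schemata(1)]) auto
  qed
  ultimately have "\<tturnstile> fpow \<alpha> k \<^bold>\<rightarrow> fpow \<alpha> (Suc m) \<^bold>\<rightarrow> \<alpha> \<^bold>\<rightarrow> \<chi>"
    by (rule mtl_exchange[OF mtl_trans])
  then have "\<tturnstile> fpow \<alpha> (k + Suc m) \<^bold>\<rightarrow> \<alpha> \<^bold>\<rightarrow> \<chi>"
    using Suc.IH \<open>k \<ge> 1\<close> by blast
  then show ?case by (auto dest: mtl_uncurry)
qed

end

text \<open>Without contraction, the two uses of \<open>\<alpha>\<close> behind the premises of a modus ponens cannot be
  identified; the exponents add up instead.\<close>

lemma mtl_local_deduction:
  assumes "derives (mtl ar) (insert \<alpha> \<Gamma>) \<phi>" and \<alpha>: "wff ar \<alpha>"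
  shows "\<exists>k\<ge>1. derives (mtl ar) \<Gamma> (fpow \<alpha> k \<^bold>\<rightarrow> \<phi>)"
proof -
  have one: "\<exists>k\<ge>1. derives (mtl ar) \<Gamma> (fpow \<alpha> k \<^bold>\<rightarrow> \<psi>)" if "derives (mtl ar) \<Gamma> \<psi>" for \<psi>
    using mtl_const[OF that \<alpha>] by (intro exI[of _ 1]) simp
  show ?thesis
    using assms(1)
  proof (induction rule: mtl_induct)
    case (hypothesis \<phi>)
    show ?case
    proof (cases "\<phi> = \<alpha>")
      case True
      then show ?thesis using mtl_refl[OF \<alpha>] by (intro exI[of _ 1]) simp
    next
      case False
      then show ?thesis using hypothesis by (intro one derives.hypothesis) auto
    qed
  next
    case (axiom_instance \<beta> \<sigma>)
    then show ?case by (intro one derives.axiom_instance) auto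
  next
    case (mp \<phi> \<psi>)
    then obtain k m where "k \<ge> 1" "m \<ge> 1" "derives (mtl ar) \<Gamma> (fpow \<alpha> k \<^bold>\<rightarrow> \<phi>)"
      "derives (mtl ar) \<Gamma> (fpow \<alpha> m \<^bold>\<rightarrow> \<phi> \<^bold>\<rightarrow> \<psi>)" by blast
    moreover from this have "derives (mtl ar) \<Gamma> (fpow \<alpha> k \<^bold>\<rightarrow> fpow \<alpha> m \<^bold>\<rightarrow> \<psi>)"
      using mtl_trans mtl_exchange by blast
    ultimately show ?case
      using mtl_fpow_add[of ar \<Gamma> \<alpha> k "m - 1" \<psi>] by (intro exI[of _ "k + m"]) auto
  qed
qed

text \<open>Attach \<open>\<delta>\<close> to every line of the derivation. Lines that do not depend on \<open>\<alpha>\<close> can be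
  weakened to the disjunction, and the others are kept by \<open>mtl_mp_join\<close>.\<close>

lemma mtl_disjoin:
  assumes "derives (mtl ar) (insert \<alpha> \<Gamma>) \<phi>" and \<delta>: "wff ar \<delta>"
  shows "derives (mtl ar) (insert (\<alpha> \<^bold>\<or> \<delta>) \<Gamma>) (\<phi> \<^bold>\<or> \<delta>)"
proof -
  have left: "derives (mtl ar) \<Delta> (\<psi> \<^bold>\<or> \<delta>)" if "derives (mtl ar) \<Delta> \<psi>" for \<Delta> \<psi>
    using mtl_mp[OF mtl_join_left that] mtl_wff[OF that] \<delta> by simp
  show ?thesis
    using assms(1)
  proof (induction rule: mtl_induct)
    case (hypothesis \<phi>)
    show ?case
    proof (cases "\<phi> = \<alpha>")
      case True
      then show ?thesis using hypothesis \<delta> by (intro derives.hypothesis) auto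
    next
      case False
      then show ?thesis using hypothesis by (intro left derives.hypothesis) auto
    qed
  next
    case (axiom_instance \<beta> \<sigma>)
    then show ?case by (intro left derives.axiom_instance) auto
  next
    case (mp \<phi> \<psi>)
    then show ?case using mtl_mp_join by blast
  qed
qed

text \<open>Two applications of \<open>mtl_disjoin\<close>: the derivation from \<open>\<alpha>\<close> turns \<open>\<alpha> \<or> \<beta>\<close> into
  \<open>\<phi> \<or> \<beta>\<close>, and the one from \<open>\<beta>\<close> turns \<open>\<beta> \<or> \<phi>\<close> into \<open>\<phi> \<or> \<phi>\<close>.\<close>

lemma mtl_cases:
  assumes \<alpha>: "derives (mtl ar) (insert \<alpha> \<Gamma>) \<phi>" and \<beta>: "derives (mtl ar) (insert \<beta> \<Gamma>) \<phi>"
    and "wff ar \<beta>"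
  shows "derives (mtl ar) (insert (\<alpha> \<^bold>\<or> \<beta>) \<Gamma>) \<phi>"
proof -
  have "derives (mtl ar) (insert (\<beta> \<^bold>\<or> \<phi>) \<Gamma>) \<phi>"
    using mtl_join_idem mtl_disjoin[OF \<beta> mtl_wff[OF \<beta>]] by blast
  then show ?thesis
  proof (rule derives_cut)
    fix \<gamma> assume \<gamma>: "\<gamma> \<in> insert (\<beta> \<^bold>\<or> \<phi>) \<Gamma>" "wff (arity (mtl ar)) \<gamma>"
    have "derives (mtl ar) (insert (\<alpha> \<^bold>\<or> \<beta>) \<Gamma>) (\<beta> \<^bold>\<or> \<phi>)"
      using mtl_join_commute mtl_disjoin[OF \<alpha> \<open>wff ar \<beta>\<close>] by blast
    with \<gamma> show "derives (mtl ar) (insert (\<alpha> \<^bold>\<or> \<beta>) \<Gamma>) \<gamma>"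
      by (auto intro: derives.hypothesis)
  qed
qed

section \<open>Tautologies follow from excluded middle for variables\<close>

definition literal :: "bool \<Rightarrow> nat \<Rightarrow> 'c fm" where
  "literal b p = (if b then Var p else \<^bold>\<not> Var p)"

text \<open>Kalmar's lemma. Hypotheses of a derivation may be used repeatedly, so the missing
  contraction does no harm here, and the truth tables of \<open>\<and>\<close> and \<open>&\<close> come out alike.\<close>

lemma mtl_decides:
  assumes "wff Map.empty \<phi>"
    and "\<And>p. p \<in> vars \<phi> \<Longrightarrow> derives (mtl ar) \<Gamma> (literal (v p) p)"
  shows "derives (mtl ar) \<Gamma> (if truth v \<phi> then \<phi> else \<^bold>\<not> \<phi>)"
  using assms
proof (induction \<phi>)
  case Bot
  show ?case using mtl_refl[of ar "\<^bold>0"] by simp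
next
  case (And \<phi> \<psi>)
  then have "wff ar \<phi>" "wff ar \<psi>" using wff_extend_language by auto
  then show ?case
    using And mtl_meetI mtl_trans[OF mtl_meet_left] mtl_trans[OF mtl_meet_right]
    by (auto split: if_splits)
next
  case (Fuse \<phi> \<psi>)
  then have "wff ar \<phi>" "wff ar \<psi>" using wff_extend_language by auto
  then show ?case
    using Fuse mtl_fuseI mtl_trans[OF mtl_fuse_left] mtl_trans[OF mtl_fuse_right]
    by (auto split: if_splits)
next
  case (Imp \<phi> \<psi>)
  then have wff: "wff ar \<phi>" "wff ar \<psi>" using wff_extend_language by auto
  have IH: "derives (mtl ar) \<Gamma> (if truth v \<phi> then \<phi> else \<^bold>\<not> \<phi>)"
    "derives (mtl ar) \<Gamma> (if truth v \<psi> then \<psi> else \<^bold>\<not> \<psi>)"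
    using Imp by auto
  consider "truth v \<psi>" | "\<not> truth v \<phi>" | "truth v \<phi>" "\<not> truth v \<psi>" by blast
  then show ?case
  proof cases
    case 1
    then show ?thesis using IH wff mtl_const by auto
  next
    case 2
    have "derives (mtl ar) \<Gamma> (\<^bold>0 \<^bold>\<rightarrow> \<psi>)"
      using wff by (intro mtl_axiom_schemata(10)[where \<psi> = "\<^bold>0" and \<chi> = "\<^bold>0"]) auto
    then show ?thesis using 2 IH mtl_trans by auto
  next
    case 3
    then have "derives (mtl ar) \<Gamma> \<phi>" "derives (mtl ar) \<Gamma> (\<^bold>\<not> \<psi>)" using IH by auto
    then have "derives (mtl ar) \<Gamma> (\<^bold>\<not> (\<phi> \<^bold>\<rightarrow> \<psi>))"
      using mtl_trans[OF mtl_mp[OF mtl_assertion]] wff by blast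
    then show ?thesis using 3 by simp
  qed
qed (auto simp: literal_def)

text \<open>The variables are freed one by one: derivations from \<open>p\<close> and from \<open>\<not> p\<close>, both under the same
  valuation of the other variables, merge by \<open>mtl_cases\<close>.\<close>

lemma mtl_merge_literals:
  fixes \<Gamma> :: "'c fm set"
  assumes "finite S"
    and "\<And>v. derives (mtl ar) (\<Gamma> \<union> (\<lambda>p. literal (v p) p) ` S) \<phi>"
  shows "derives (mtl ar) (\<Gamma> \<union> (\<lambda>p. Var p \<^bold>\<or> \<^bold>\<not> Var p) ` S) \<phi>"
  using assms
proof (induction S arbitrary: \<Gamma> rule: finite_induct)
  case (insert p S)
  have "derives (mtl ar) (insert (literal b p) \<Gamma> \<union> (\<lambda>p. Var p \<^bold>\<or> \<^bold>\<not> Var p) ` S) \<phi>" for b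
  proof (rule insert.IH)
    fix v
    have "(\<lambda>q. literal ((v(p := b)) q) q :: 'c fm) ` S = (\<lambda>q. literal (v q) q) ` S"
      using insert.hyps by (intro image_cong) auto
    then have "\<Gamma> \<union> (\<lambda>q. literal ((v(p := b)) q) q) ` insert p S =
        insert (literal b p) \<Gamma> \<union> (\<lambda>q. literal (v q) q) ` S"
      by (simp only: image_insert fun_upd_same Un_insert_left Un_insert_right)
    with insert.prems[of "v(p := b)"]
    show "derives (mtl ar) (insert (literal b p) \<Gamma> \<union> (\<lambda>q. literal (v q) q) ` S) \<phi>" by (simp only:)
  qed
  from this[of True] this[of False] show ?case
    using mtl_cases[of ar "Var p" _ \<phi> "\<^bold>\<not> Var p"] by (simp add: literal_def)
qed simp

text \<open>The language is arbitrary because the theorem is needed twice: in the empty language, to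
  obtain classical derivations, and in the language with \<open>\<circ>\<close>.\<close>

theorem tautology_from_excluded_middle:
  assumes "wff Map.empty \<phi>" and "\<And>v. truth v \<phi>"
  shows "derives (mtl ar) ((\<lambda>p. Var p \<^bold>\<or> \<^bold>\<not> Var p) ` vars \<phi>) \<phi>"
proof -
  have "derives (mtl ar) ({} \<union> (\<lambda>p. literal (v p) p) ` vars \<phi>) \<phi>" for v
  proof -
    have "derives (mtl ar) ((\<lambda>p. literal (v p) p) ` vars \<phi>) (literal (v p) p)" if "p \<in> vars \<phi>" for p
      using that by (intro derives.hypothesis) (auto simp: literal_def)
    from mtl_decides[OF assms(1) this] assms(2) show ?thesis by simp
  qed
  then show ?thesis using mtl_merge_literals[OF finite_vars[of \<phi>], of ar "{}" \<phi>] by simp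
qed


section \<open>Classical logic proves the axioms of MTL\<close>

lemma cpl_simps [simp]:
  "arity cpl = Map.empty" "rules cpl = {modus_ponens}"
  by (simp_all add: cpl_def)

lemmas cpl_axioms = arg_cong[OF cpl_def, of axioms, simplified logic.select_convs Let_def]

lemma wff_cpl_axioms: "\<alpha> \<in> axioms cpl \<Longrightarrow> wff ar \<alpha>"
  by (auto simp: cpl_def Let_def)

lemma cpl_wff: "derives cpl \<Gamma> \<phi> \<Longrightarrow> wff Map.empty \<phi>"
  by (erule modus_ponens_induct) (simp_all add: wff_cpl_axioms)

lemma cpl_hyp: "\<lbrakk>\<phi> \<in> \<Gamma>; wff Map.empty \<phi>\<rbrakk> \<Longrightarrow> derives cpl \<Gamma> \<phi>"
  by (rule derives.hypothesis) simp_all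

lemma cpl_mp: "\<lbrakk>derives cpl \<Gamma> (\<phi> \<^bold>\<rightarrow> \<psi>); derives cpl \<Gamma> \<phi>\<rbrakk> \<Longrightarrow> derives cpl \<Gamma> \<psi>"
  using derives_mp[of cpl \<phi> \<psi> \<Gamma>] cpl_wff[of \<Gamma> "\<phi> \<^bold>\<rightarrow> \<psi>"] by simp

lemma cpl_axiom_instances:
  assumes "wff Map.empty \<phi>" "wff Map.empty \<psi>" "wff Map.empty \<chi>"
  shows "\<forall>\<alpha> \<in> axioms cpl. derives cpl \<Gamma> (subst (metavars \<phi> \<psi> \<chi>) \<alpha>)"
  using derives_axiom[of _ cpl \<phi> \<psi> \<chi> \<Gamma>] assms by simp

lemma cpl_axiom_schemata:
  assumes [simp]: "wff Map.empty \<phi>" "wff Map.empty \<psi>" "wff Map.empty \<chi>"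
  shows "derives cpl \<Gamma> (\<phi> \<^bold>\<rightarrow> \<psi> \<^bold>\<rightarrow> \<phi>)"
    and "derives cpl \<Gamma> ((\<phi> \<^bold>\<rightarrow> \<psi> \<^bold>\<rightarrow> \<chi>) \<^bold>\<rightarrow> (\<phi> \<^bold>\<rightarrow> \<psi>) \<^bold>\<rightarrow> \<phi> \<^bold>\<rightarrow> \<chi>)"
    and "derives cpl \<Gamma> (\<phi> \<^bold>\<and> \<psi> \<^bold>\<rightarrow> \<phi>)"
    and "derives cpl \<Gamma> (\<phi> \<^bold>\<and> \<psi> \<^bold>\<rightarrow> \<psi>)"
    and "derives cpl \<Gamma> (\<phi> \<^bold>\<rightarrow> \<psi> \<^bold>\<rightarrow> \<phi> \<^bold>\<and> \<psi>)"
    and "derives cpl \<Gamma> (\<phi> \<^bold>& \<psi> \<^bold>\<rightarrow> \<phi>)"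
    and "derives cpl \<Gamma> (\<phi> \<^bold>& \<psi> \<^bold>\<rightarrow> \<psi>)"
    and "derives cpl \<Gamma> (\<phi> \<^bold>\<rightarrow> \<psi> \<^bold>\<rightarrow> \<phi> \<^bold>& \<psi>)"
    and "derives cpl \<Gamma> (\<^bold>0 \<^bold>\<rightarrow> \<phi>)"
    and "derives cpl \<Gamma> (\<^bold>\<not> \<^bold>\<not> \<phi> \<^bold>\<rightarrow> \<phi>)"
  using cpl_axiom_instances[OF assms, unfolded cpl_axioms, simplified] by blast+

lemma cpl_impI:
  fixes \<alpha> :: "'a fm"
  assumes "derives cpl (insert \<alpha> \<Gamma>) \<phi>" and \<alpha>: "wff Map.empty \<alpha>"
  shows "derives cpl \<Gamma> (\<alpha> \<^bold>\<rightarrow> \<phi>)"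
proof -
  have K: "derives cpl \<Gamma> (\<alpha> \<^bold>\<rightarrow> \<psi>)" if "derives cpl \<Gamma> \<psi>" for \<psi>
    using cpl_mp[OF cpl_axiom_schemata(1)[where \<chi> = "\<^bold>0"] that] cpl_wff[OF that] \<alpha> by simp
  have S: "derives cpl \<Gamma> (\<alpha> \<^bold>\<rightarrow> \<psi>)"
    if "derives cpl \<Gamma> (\<alpha> \<^bold>\<rightarrow> \<beta> \<^bold>\<rightarrow> \<psi>)" "derives cpl \<Gamma> (\<alpha> \<^bold>\<rightarrow> \<beta>)" for \<beta> \<psi>
    using cpl_mp[OF cpl_mp[OF cpl_axiom_schemata(2) that(1)] that(2)] cpl_wff[OF that(1)] by simp
  have refl: "derives cpl \<Gamma> (\<alpha> \<^bold>\<rightarrow> \<alpha>)"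
    using S[OF cpl_axiom_schemata(1)[where \<chi> = "\<^bold>0"] cpl_axiom_schemata(1)[where \<chi> = "\<^bold>0"], of "\<alpha> \<^bold>\<rightarrow> \<alpha>"] \<alpha> by simp
  show ?thesis
  proof (rule modus_ponens_induct[OF assms(1)])
    fix \<phi> assume "\<phi> \<in> insert \<alpha> \<Gamma>" "wff (arity cpl) \<phi>"
    then show "derives cpl \<Gamma> (\<alpha> \<^bold>\<rightarrow> \<phi>)" using refl K cpl_hyp by auto
  next
    fix \<beta> :: "'a fm" and \<sigma> :: "nat \<Rightarrow> 'a fm"
    assume "\<beta> \<in> axioms cpl" "\<And>n. wff (arity cpl) (\<sigma> n)"
    then show "derives cpl \<Gamma> (\<alpha> \<^bold>\<rightarrow> subst \<sigma> \<beta>)" by (rule K[OF derives.axiom_instance])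
  next
    fix \<beta> \<psi> assume "derives cpl \<Gamma> (\<alpha> \<^bold>\<rightarrow> \<beta>)" "derives cpl \<Gamma> (\<alpha> \<^bold>\<rightarrow> \<beta> \<^bold>\<rightarrow> \<psi>)"
    then show "derives cpl \<Gamma> (\<alpha> \<^bold>\<rightarrow> \<psi>)" by (rule S[rotated])
  qed (simp_all add: wff_cpl_axioms)
qed

lemma cpl_meetI:
  assumes "derives cpl \<Gamma> \<phi>" "derives cpl \<Gamma> \<psi>"
  shows "derives cpl \<Gamma> (\<phi> \<^bold>\<and> \<psi>)"
  using cpl_mp[OF cpl_mp[OF cpl_axiom_schemata(5)[where \<chi> = "\<^bold>0"] assms(1)] assms(2)] cpl_wff[OF assms(1)] cpl_wff[OF assms(2)] by simp

lemma cpl_fuseI: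
  assumes "derives cpl \<Gamma> \<phi>" "derives cpl \<Gamma> \<psi>"
  shows "derives cpl \<Gamma> (\<phi> \<^bold>& \<psi>)"
  using cpl_mp[OF cpl_mp[OF cpl_axiom_schemata(8)[where \<chi> = "\<^bold>0"] assms(1)] assms(2)] cpl_wff[OF assms(1)] cpl_wff[OF assms(2)] by simp

lemma cpl_meetE:
  assumes "derives cpl \<Gamma> (\<phi> \<^bold>\<and> \<psi>)"
  shows "derives cpl \<Gamma> \<phi>" "derives cpl \<Gamma> \<psi>"
  using cpl_mp[OF cpl_axiom_schemata(3)[where \<chi> = "\<^bold>0"] assms] cpl_mp[OF cpl_axiom_schemata(4)[where \<chi> = "\<^bold>0"] assms]
    cpl_wff[OF assms] by simp_all

lemma cpl_fuseE:
  assumes "derives cpl \<Gamma> (\<phi> \<^bold>& \<psi>)"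
  shows "derives cpl \<Gamma> \<phi>" "derives cpl \<Gamma> \<psi>"
  using cpl_mp[OF cpl_axiom_schemata(6)[where \<chi> = "\<^bold>0"] assms] cpl_mp[OF cpl_axiom_schemata(7)[where \<chi> = "\<^bold>0"] assms]
    cpl_wff[OF assms] by simp_all

lemma cpl_contradiction:
  assumes "derives cpl (insert (\<^bold>\<not> \<phi>) \<Gamma>) \<^bold>0" and "wff Map.empty \<phi>"
  shows "derives cpl \<Gamma> \<phi>"
  using cpl_mp[OF cpl_axiom_schemata(10)[where \<psi> = "\<^bold>0" and \<chi> = "\<^bold>0"] cpl_impI[OF assms(1)]] assms(2) by simp

text \<open>With the classical deduction theorem \<open>cpl_impI\<close> at hand these are natural deduction proofs;
  only the prelinearity axiom is proved by contradiction.\<close>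

lemma cpl_mtl_axioms:
  fixes \<sigma> :: "nat \<Rightarrow> 'c fm"
  assumes "\<alpha> \<in> mtl_axioms" and \<sigma>: "\<And>n. wff Map.empty (\<sigma> n)"
  shows "derives cpl \<Gamma> (subst \<sigma> \<alpha>)"
proof -
  define \<phi> \<psi> \<chi> where \<phi>_def: "\<phi> = \<sigma> 0" and \<psi>_def: "\<psi> = \<sigma> 1" and \<chi>_def: "\<chi> = \<sigma> 2"
  have [simp]: "wff Map.empty \<phi>" "wff Map.empty \<psi>" "wff Map.empty \<chi>"
    using \<sigma> by (simp_all add: \<phi>_def \<psi>_def \<chi>_def)
  have "derives cpl \<Gamma> ((\<phi> \<^bold>\<rightarrow> \<psi>) \<^bold>\<rightarrow> (\<psi> \<^bold>\<rightarrow> \<chi>) \<^bold>\<rightarrow> \<phi> \<^bold>\<rightarrow> \<chi>)"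
  proof (intro cpl_impI)
    let ?\<Delta> = "insert \<phi> (insert (\<psi> \<^bold>\<rightarrow> \<chi>) (insert (\<phi> \<^bold>\<rightarrow> \<psi>) \<Gamma>))"
    have "derives cpl ?\<Delta> \<psi>" by (rule cpl_mp[of _ \<phi>]; rule cpl_hyp; simp)
    then show "derives cpl ?\<Delta> \<chi>" by (rule cpl_mp[rotated]) (rule cpl_hyp; simp)
  qed auto
  moreover have "derives cpl \<Gamma> (\<phi> \<^bold>& \<psi> \<^bold>\<rightarrow> \<phi>)" "derives cpl \<Gamma> (\<phi> \<^bold>\<and> \<psi> \<^bold>\<rightarrow> \<phi>)"
    "derives cpl \<Gamma> (\<^bold>0 \<^bold>\<rightarrow> \<phi>)"
    using cpl_axiom_schemata(3,6,9)[of \<phi> \<psi> \<chi> \<Gamma>] by simp_all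
  moreover have "derives cpl \<Gamma> (\<phi> \<^bold>& \<psi> \<^bold>\<rightarrow> \<psi> \<^bold>& \<phi>)"
  proof (rule cpl_impI)
    have "derives cpl (insert (\<phi> \<^bold>& \<psi>) \<Gamma>) (\<phi> \<^bold>& \<psi>)" by (rule cpl_hyp) simp_all
    then show "derives cpl (insert (\<phi> \<^bold>& \<psi>) \<Gamma>) (\<psi> \<^bold>& \<phi>)"
      using cpl_fuseE cpl_fuseI by blast
  qed simp
  moreover have "derives cpl \<Gamma> (\<phi> \<^bold>\<and> \<psi> \<^bold>\<rightarrow> \<psi> \<^bold>\<and> \<phi>)"
  proof (rule cpl_impI)
    have "derives cpl (insert (\<phi> \<^bold>\<and> \<psi>) \<Gamma>) (\<phi> \<^bold>\<and> \<psi>)" by (rule cpl_hyp) simp_all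
    then show "derives cpl (insert (\<phi> \<^bold>\<and> \<psi>) \<Gamma>) (\<psi> \<^bold>\<and> \<phi>)"
      using cpl_meetE cpl_meetI by blast
  qed simp
  moreover have "derives cpl \<Gamma> (\<phi> \<^bold>& (\<phi> \<^bold>\<rightarrow> \<psi>) \<^bold>\<rightarrow> \<phi> \<^bold>\<and> \<psi>)"
  proof (rule cpl_impI)
    let ?\<Delta> = "insert (\<phi> \<^bold>& (\<phi> \<^bold>\<rightarrow> \<psi>)) \<Gamma>"
    have "derives cpl ?\<Delta> (\<phi> \<^bold>& (\<phi> \<^bold>\<rightarrow> \<psi>))" by (rule cpl_hyp) simp_all
    then have "derives cpl ?\<Delta> \<phi>" "derives cpl ?\<Delta> (\<phi> \<^bold>\<rightarrow> \<psi>)" using cpl_fuseE by blast+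
    then show "derives cpl ?\<Delta> (\<phi> \<^bold>\<and> \<psi>)" using cpl_mp cpl_meetI by blast
  qed simp
  moreover have "derives cpl \<Gamma> ((\<phi> \<^bold>\<rightarrow> \<psi> \<^bold>\<rightarrow> \<chi>) \<^bold>\<rightarrow> \<phi> \<^bold>& \<psi> \<^bold>\<rightarrow> \<chi>)"
  proof (intro cpl_impI)
    let ?\<Delta> = "insert (\<phi> \<^bold>& \<psi>) (insert (\<phi> \<^bold>\<rightarrow> \<psi> \<^bold>\<rightarrow> \<chi>) \<Gamma>)"
    have "derives cpl ?\<Delta> (\<phi> \<^bold>& \<psi>)" "derives cpl ?\<Delta> (\<phi> \<^bold>\<rightarrow> \<psi> \<^bold>\<rightarrow> \<chi>)" by (rule cpl_hyp; simp)+
    then show "derives cpl ?\<Delta> \<chi>" using cpl_fuseE cpl_mp by metis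
  qed auto
  moreover have "derives cpl \<Gamma> ((\<phi> \<^bold>& \<psi> \<^bold>\<rightarrow> \<chi>) \<^bold>\<rightarrow> \<phi> \<^bold>\<rightarrow> \<psi> \<^bold>\<rightarrow> \<chi>)"
  proof (intro cpl_impI)
    let ?\<Delta> = "insert \<psi> (insert \<phi> (insert (\<phi> \<^bold>& \<psi> \<^bold>\<rightarrow> \<chi>) \<Gamma>))"
    have "derives cpl ?\<Delta> \<phi>" "derives cpl ?\<Delta> \<psi>" "derives cpl ?\<Delta> (\<phi> \<^bold>& \<psi> \<^bold>\<rightarrow> \<chi>)"
      by (rule cpl_hyp; simp)+
    then show "derives cpl ?\<Delta> \<chi>" using cpl_fuseI cpl_mp by blast
  qed auto
  moreover have "derives cpl \<Gamma> (((\<phi> \<^bold>\<rightarrow> \<psi>) \<^bold>\<rightarrow> \<chi>) \<^bold>\<rightarrow> ((\<psi> \<^bold>\<rightarrow> \<phi>) \<^bold>\<rightarrow> \<chi>) \<^bold>\<rightarrow> \<chi>)"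
  proof (intro cpl_impI, rule cpl_contradiction)
    let ?\<Delta> = "insert (\<^bold>\<not> \<chi>) (insert ((\<psi> \<^bold>\<rightarrow> \<phi>) \<^bold>\<rightarrow> \<chi>) (insert ((\<phi> \<^bold>\<rightarrow> \<psi>) \<^bold>\<rightarrow> \<chi>) \<Gamma>))"
    have "derives cpl (insert \<psi> ?\<Delta>) (\<phi> \<^bold>\<rightarrow> \<psi>)" by (intro cpl_impI cpl_hyp) simp_all
    moreover have "derives cpl (insert \<psi> ?\<Delta>) ((\<phi> \<^bold>\<rightarrow> \<psi>) \<^bold>\<rightarrow> \<chi>)"
      "derives cpl (insert \<psi> ?\<Delta>) (\<^bold>\<not> \<chi>)" by (rule cpl_hyp; simp)+
    ultimately have "derives cpl (insert \<psi> ?\<Delta>) \<^bold>0" using cpl_mp by blast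
    then have "derives cpl (insert \<psi> ?\<Delta>) \<phi>"
      by (rule cpl_mp[OF cpl_axiom_schemata(9)[where \<psi> = "\<^bold>0" and \<chi> = "\<^bold>0"], rotated -1]) simp_all
    then have "derives cpl ?\<Delta> (\<psi> \<^bold>\<rightarrow> \<phi>)" by (rule cpl_impI) simp
    moreover have "derives cpl ?\<Delta> ((\<psi> \<^bold>\<rightarrow> \<phi>) \<^bold>\<rightarrow> \<chi>)" "derives cpl ?\<Delta> (\<^bold>\<not> \<chi>)"
      by (rule cpl_hyp; simp)+
    ultimately show "derives cpl ?\<Delta> \<^bold>0" using cpl_mp by blast
  qed auto
  ultimately show ?thesis
    using assms(1) by (auto simp: mtl_axioms_def Let_def \<phi>_def \<psi>_def \<chi>_def numeral_2_eq_2)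
qed

lemma cpl_excluded_middle:
  assumes [simp]: "wff Map.empty \<phi>"
  shows "derives cpl \<Gamma> (\<phi> \<^bold>\<or> \<^bold>\<not> \<phi>)"
proof (rule cpl_meetI)
  show "derives cpl \<Gamma> ((\<phi> \<^bold>\<rightarrow> \<^bold>\<not> \<phi>) \<^bold>\<rightarrow> \<^bold>\<not> \<phi>)"
  proof (intro cpl_impI)
    let ?\<Delta> = "insert \<phi> (insert (\<phi> \<^bold>\<rightarrow> \<^bold>\<not> \<phi>) \<Gamma>)"
    have "derives cpl ?\<Delta> \<phi>" "derives cpl ?\<Delta> (\<phi> \<^bold>\<rightarrow> \<^bold>\<not> \<phi>)" by (rule cpl_hyp; simp)+
    then show "derives cpl ?\<Delta> \<^bold>0" using cpl_mp by blast
  qed simp_all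
  show "derives cpl \<Gamma> ((\<^bold>\<not> \<phi> \<^bold>\<rightarrow> \<phi>) \<^bold>\<rightarrow> \<phi>)"
  proof (rule cpl_impI, rule cpl_contradiction)
    let ?\<Delta> = "insert (\<^bold>\<not> \<phi>) (insert (\<^bold>\<not> \<phi> \<^bold>\<rightarrow> \<phi>) \<Gamma>)"
    have "derives cpl ?\<Delta> (\<^bold>\<not> \<phi>)" "derives cpl ?\<Delta> (\<^bold>\<not> \<phi> \<^bold>\<rightarrow> \<phi>)" by (rule cpl_hyp; simp)+
    then show "derives cpl ?\<Delta> \<^bold>0" using cpl_mp by blast
  qed simp_all
qed

theorem cpl_complete:
  assumes "wff Map.empty \<phi>" and "\<And>v. truth v \<phi>"
  shows "\<turnstile>\<^bsub>cpl\<^esub> \<phi>"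
proof (rule derives_cut)
  show "derives cpl ((\<lambda>p. Var p \<^bold>\<or> \<^bold>\<not> Var p) ` vars \<phi>) \<phi>"
    by (rule mtl_embed) (use tautology_from_excluded_middle[OF assms] in simp, simp,
        rule cpl_mtl_axioms, simp_all)
qed (auto intro!: cpl_excluded_middle)


section \<open>Chains expanded by a two-valued consistency operator\<close>

lemma eval_subst: "eval A e (subst \<sigma> \<phi>) = eval A (\<lambda>n. eval A e (\<sigma> n)) \<phi>"
  by (induction \<phi>) (simp_all add: comp_def cong: map_cong)

lemma algebra_ops_closed:
  "\<lbrakk>is_algebra L A; arity L c = Some (length xs); set xs \<subseteq> carrier A\<rbrakk> \<Longrightarrow> ops A c xs \<in> carrier A"
  by (simp add: is_algebra_def)

lemma algebra_axiom:
  assumes "is_algebra L A" "evaluation A e" "\<alpha> \<in> axioms L"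
  shows "eval A e \<alpha> = \<one>\<^bsub>A\<^esub>"
  using assms unfolding is_algebra_def by blast

lemma algebra_rule:
  assumes "is_algebra L A" "evaluation A e" "(P, \<gamma>) \<in> rules L"
    and "\<And>\<pi>. \<pi> \<in> P \<Longrightarrow> eval A e \<pi> = \<one>\<^bsub>A\<^esub>"
  shows "eval A e \<gamma> = \<one>\<^bsub>A\<^esub>"
proof -
  have "case (P, \<gamma>) of (P, \<gamma>) \<Rightarrow> (\<forall>\<pi> \<in> P. eval A e \<pi> = \<one>\<^bsub>A\<^esub>) \<longrightarrow> eval A e \<gamma> = \<one>\<^bsub>A\<^esub>"
    using assms(1-3) unfolding is_algebra_def by blast
  then show ?thesis using assms(4) by simp
qed

lemma eval_closed:
  assumes A: "is_algebra L A" and e: "evaluation A e" and \<psi>: "wff (arity L) \<psi>"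
  shows "eval A e \<psi> \<in> carrier A"
proof -
  interpret mtl_algebra A using A by (simp add: is_algebra_def)
  show ?thesis
    by (rule eval_in_subuniverse[OF _ _ _ _ _ e \<psi>])
      (use A in \<open>auto simp: mt_closed residuum_closed zer_closed intro: algebra_ops_closed\<close>)
qed

lemma algebra_sound:
  assumes A: "is_algebra L A" and e: "evaluation A e" and "\<turnstile>\<^bsub>L\<^esub> \<phi>"
  shows "eval A e \<phi> = \<one>\<^bsub>A\<^esub>"
proof -
  have subst: "evaluation A (\<lambda>n. eval A e (\<sigma> n))" if "\<And>n. wff (arity L) (\<sigma> n)" for \<sigma>
    using eval_closed[OF A e that] by blast
  show ?thesis
    using assms(3)
  proof induction
    case (axiom_instance \<alpha> \<sigma>)
    then show ?case using algebra_axiom[OF A subst] by (simp add: eval_subst)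
  next
    case (rule_instance P \<gamma> \<sigma>)
    then show ?case
      using algebra_rule[OF A subst rule_instance.hyps(1)] by (simp add: eval_subst)
  qed simp
qed

context mtl_algebra
begin

lemma mt_idem: "x \<in> carrier A \<Longrightarrow> x \<^bold>\<sqinter> x = x"
  using mt_absorb[of x "x \<^bold>\<sqinter> x"] jn_absorb[of x x] mt_closed by simp

lemma below_antisym: "\<lbrakk>x \<in> carrier A; y \<in> carrier A; x \<preceq> y; y \<preceq> x\<rbrakk> \<Longrightarrow> x = y"
  using mt_comm[of x y] by (simp add: below_def)

lemma one_below_iff: "x \<in> carrier A \<Longrightarrow> \<one> \<preceq> x \<longleftrightarrow> x = \<one>"
  using below_antisym[of x \<one>] below_one[of x] mt_idem[of \<one>] by (auto simp: below_def)

lemma residuum_eq_one_iff: "\<lbrakk>x \<in> carrier A; y \<in> carrier A\<rbrakk> \<Longrightarrow> x \<leadsto> y = \<one> \<longleftrightarrow> x \<preceq> y"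
  using residuation[of \<one> x y] one_below_iff[of "x \<leadsto> y"] by (simp add: residuum_closed)

lemma one_residuum: "x \<in> carrier A \<Longrightarrow> \<one> \<leadsto> x = x"
  using residuation[of x \<one> x] residuation[of "\<one> \<leadsto> x" \<one> x]
  by (intro below_antisym) (auto simp: residuum_closed below_def mt_idem)

lemma one_mt: "x \<in> carrier A \<Longrightarrow> \<one> \<^bold>\<sqinter> x = x"
  using below_one[of x] mt_comm[of \<one> x] by (simp add: below_def)

lemma zer_mt: "x \<in> carrier A \<Longrightarrow> \<^bold>\<bottom> \<^bold>\<sqinter> x = \<^bold>\<bottom>" "x \<in> carrier A \<Longrightarrow> x \<^bold>\<sqinter> \<^bold>\<bottom> = \<^bold>\<bottom>"
  using zer_below[of x] mt_comm[of "\<^bold>\<bottom>" x] zer_closed by (auto simp: below_def)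

lemma mt_eq_one_iff: "\<lbrakk>x \<in> carrier A; y \<in> carrier A\<rbrakk> \<Longrightarrow> x \<^bold>\<sqinter> y = \<one> \<longleftrightarrow> x = \<one> \<and> y = \<one>"
proof
  assume xy: "x \<in> carrier A" "y \<in> carrier A" "x \<^bold>\<sqinter> y = \<one>"
  then have "x \<^bold>\<sqinter> (x \<^bold>\<sqinter> y) = x \<^bold>\<sqinter> y" using mt_assoc[of x x y] mt_idem[of x] by simp
  then have "x = \<one>" using xy one_mt[of x] mt_comm[of x \<one>] by simp
  then show "x = \<one> \<and> y = \<one>" using xy one_mt[of y] by simp
qed (simp add: mt_idem)

lemma zer_mult: "x \<in> carrier A \<Longrightarrow> \<^bold>\<bottom> \<otimes> x = \<^bold>\<bottom>"
proof -
  assume x: "x \<in> carrier A"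
  then have "\<^bold>\<bottom> \<otimes> x \<preceq> \<^bold>\<bottom>"
    using residuation[of "\<^bold>\<bottom>" x "\<^bold>\<bottom>"] zer_below[of "x \<leadsto> \<^bold>\<bottom>"] by (simp add: zer_closed residuum_closed)
  then show ?thesis
    using x zer_below[of "\<^bold>\<bottom> \<otimes> x"] by (intro below_antisym) (auto simp: zer_closed)
qed

lemma zer_residuum: "x \<in> carrier A \<Longrightarrow> \<^bold>\<bottom> \<leadsto> x = \<one>"
  by (simp add: residuum_eq_one_iff zer_below zer_closed)

text \<open>Disjunction is a defined connective, interpreted by a term in \<open>\<leadsto>\<close> and \<open>\<^bold>\<sqinter>\<close>. On comparable
  elements this term is their maximum, which is why the side disjunct \<open>\<delta>\<close> in the rules for \<open>\<circ>\<close> is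
  harmless in a chain.\<close>

lemma chain_Or_eq_one_iff:
  assumes "x \<in> carrier A" "y \<in> carrier A" and "x \<preceq> y \<or> y \<preceq> x"
  shows "((x \<leadsto> y) \<leadsto> y) \<^bold>\<sqinter> ((y \<leadsto> x) \<leadsto> x) = \<one> \<longleftrightarrow> x = \<one> \<or> y = \<one>"
proof -
  have *: "b \<preceq> (b \<leadsto> a) \<leadsto> a \<and> (a \<leadsto> b) \<leadsto> b = b"
    if "a \<in> carrier A" "b \<in> carrier A" "a \<preceq> b" for a b
  proof -
    have "b \<otimes> (b \<leadsto> a) \<preceq> a"
      using residuation[of "b \<leadsto> a" b a] that m_comm[of b "b \<leadsto> a"] mt_idem[of "b \<leadsto> a"]
      by (simp add: residuum_closed below_def)
    then show ?thesis
      using that residuation[of b "b \<leadsto> a" a] residuum_eq_one_iff[of a b] one_residuum[of b]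
      by (simp add: residuum_closed)
  qed
  show ?thesis
    using assms *[of x y] *[of y x] one_below_iff[of x] one_below_iff[of y]
      one_below_iff[of "(x \<leadsto> y) \<leadsto> y"] one_below_iff[of "(y \<leadsto> x) \<leadsto> x"]
    by (auto simp: mt_eq_one_iff residuum_closed)
qed

end

text \<open>The axioms force the value \<open>1\<close> at \<open>0\<close> and \<open>1\<close> and bound the other values from above only,
  so the least value is taken elsewhere.\<close>

definition circ_algebra :: "('a, 'c) alg \<Rightarrow> ('a, 'c circ) alg" where
  "circ_algebra A = \<lparr>carrier = carrier A, mult = mult A, one = \<one>\<^bsub>A\<^esub>,
     mt = mt A, jn = jn A, residuum = residuum A, zer = \<^bold>\<bottom>\<^bsub>A\<^esub>,
     ops = (\<lambda>c xs. case c of Old d \<Rightarrow> ops A d xs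
       | Circ \<Rightarrow> if hd xs \<in> {\<^bold>\<bottom>\<^bsub>A\<^esub>, \<one>\<^bsub>A\<^esub>} then \<one>\<^bsub>A\<^esub> else \<^bold>\<bottom>\<^bsub>A\<^esub>)\<rparr>"

lemma circ_algebra_simps [simp]:
  "carrier (circ_algebra A) = carrier A" "mult (circ_algebra A) = mult A"
  "one (circ_algebra A) = \<one>\<^bsub>A\<^esub>" "mt (circ_algebra A) = mt A" "jn (circ_algebra A) = jn A"
  "residuum (circ_algebra A) = residuum A" "zer (circ_algebra A) = \<^bold>\<bottom>\<^bsub>A\<^esub>"
  "ops (circ_algebra A) (Old d) xs = ops A d xs"
  "ops (circ_algebra A) Circ xs = (if hd xs \<in> {\<^bold>\<bottom>\<^bsub>A\<^esub>, \<one>\<^bsub>A\<^esub>} then \<one>\<^bsub>A\<^esub> else \<^bold>\<bottom>\<^bsub>A\<^esub>)"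
  by (simp_all add: circ_algebra_def)

lemma below_circ_algebra [simp]: "below (circ_algebra A) = below A"
  by (simp add: below_def fun_eq_iff)

lemma eval_circ_algebra_old [simp]: "eval (circ_algebra A) e (map_fm Old \<phi>) = eval A e \<phi>"
  by (induction \<phi>) (simp_all add: comp_def cong: map_cong)

lemma mtl_algebra_circ:
  assumes "mtl_algebra A"
  shows "mtl_algebra (circ_algebra A)"
proof -
  interpret mtl_algebra A by fact
  show ?thesis
    by unfold_locales
      (auto simp: m_assoc mt_closed jn_closed residuum_closed zer_closed mt_assoc jn_assoc
        mt_absorb jn_absorb zer_below below_one residuation prelinear intro: m_comm mt_comm jn_comm)
qed

lemma dat_logic_simps:
  "arity (dat_logic L) (Old c) = arity L c"
  "arity (dat_logic L) Circ = Some 1"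
  "axioms (dat_logic L) = map_fm Old ` axioms L \<union>
     {\<^bold>\<not> (Var 0 \<^bold>\<and> \<^bold>\<not> Var 0 \<^bold>\<and> \<^bold>\<circ> (Var 0)), \<^bold>\<circ> \<^bold>1, \<^bold>\<circ> \<^bold>0, \<^bold>\<circ> (Var 0) \<^bold>\<rightarrow> Var 0 \<^bold>\<or> \<^bold>\<not> (Var 0)}"
  "rules (dat_logic L) = (\<lambda>(P, \<gamma>). (map_fm Old ` P, map_fm Old \<gamma>)) ` rules L \<union>
     {({(Var 0 \<^bold>\<leftrightarrow> Var 1) \<^bold>\<or> Var 2}, (\<^bold>\<circ> (Var 0) \<^bold>\<leftrightarrow> \<^bold>\<circ> (Var 1)) \<^bold>\<or> Var 2),
      ({(\<^bold>\<not> \<^bold>\<not> Var 0 \<^bold>\<and> (Var 0 \<^bold>\<rightarrow> Var 1)) \<^bold>\<or> Var 2}, (\<^bold>\<circ> (Var 0) \<^bold>\<rightarrow> \<^bold>\<circ> (Var 1)) \<^bold>\<or> Var 2)}"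
  by (auto simp: dat_logic_def circ_logic_def Let_def)

text \<open>The value of \<open>\<circ>\<close> at \<open>x\<close> is \<open>0\<close> unless \<open>x\<close> is classical, and for classical \<open>x\<close> the
  axioms are instances of classical laws. The coherence rule asks for monotonicity of \<open>\<circ>\<close> at
  elements \<open>x \<le> y\<close> with \<open>\<not>\<not> x = 1\<close>: the only such \<open>x\<close> with \<open>\<circ>x = 1\<close> in a nontrivial chain is \<open>1\<close>,
  which forces \<open>y = 1\<close>.\<close>

lemma circ_algebra_of_chain:
  fixes A :: "('a, 'c) alg" (structure)
  assumes chain: "is_chain L A"
  shows "is_algebra (dat_logic L) (circ_algebra A)"
proof -
  have A: "is_algebra L A" using chain by (simp add: is_chain_def)
  interpret mtl_algebra A using A by (simp add: is_algebra_def)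
  let ?B = "circ_algebra A"
  let ?c = "\<lambda>x. if x \<in> {\<^bold>\<bottom>, \<one>} then \<one> else \<^bold>\<bottom>"
  have linear: "x \<preceq> y \<or> y \<preceq> x" if "x \<in> carrier A" "y \<in> carrier A" for x y
    using chain that by (simp add: is_chain_def)
  have c_closed: "?c x \<in> carrier A" for x by (simp add: zer_closed)
  have Or: "eval ?B e (\<phi> \<^bold>\<or> \<psi>) = \<one> \<longleftrightarrow> eval ?B e \<phi> = \<one> \<or> eval ?B e \<psi> = \<one>"
    if "eval ?B e \<phi> \<in> carrier A" "eval ?B e \<psi> \<in> carrier A" for e \<phi> \<psi>
    using chain_Or_eq_one_iff[OF that linear[OF that]] by simp
  have new_axioms: "eval ?B e \<alpha> = \<one>"
    if e: "evaluation A e" and \<alpha>: "\<alpha> \<in> {\<^bold>\<not> (Var 0 \<^bold>\<and> \<^bold>\<not> Var 0 \<^bold>\<and> \<^bold>\<circ> (Var 0)), \<^bold>\<circ> \<^bold>1, \<^bold>\<circ> \<^bold>0,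
      \<^bold>\<circ> (Var 0) \<^bold>\<rightarrow> Var 0 \<^bold>\<or> \<^bold>\<not> (Var 0)}" for e \<alpha>
  proof -
    have x: "e 0 \<in> carrier A" using e by blast
    have "(e 0 \<^bold>\<sqinter> (e 0 \<leadsto> \<^bold>\<bottom>)) \<^bold>\<sqinter> ?c (e 0) = \<^bold>\<bottom>"
      using x by (auto simp: zer_mt one_mt one_residuum residuum_closed zer_closed mt_closed)
    then have 1: "eval ?B e (\<^bold>\<not> (Var 0 \<^bold>\<and> \<^bold>\<not> Var 0 \<^bold>\<and> \<^bold>\<circ> (Var 0))) = \<one>"
      by (simp add: zer_residuum zer_closed)
    have 2: "eval ?B e (\<^bold>\<circ> (Var 0) \<^bold>\<rightarrow> Var 0 \<^bold>\<or> \<^bold>\<not> (Var 0)) = \<one>"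
    proof (cases "e 0 \<in> {\<^bold>\<bottom>, \<one>}")
      case True
      then have "eval ?B e (Var 0 \<^bold>\<or> \<^bold>\<not> Var 0) = \<one>"
        using Or[of e "Var 0" "\<^bold>\<not> Var 0"] x by (auto simp: residuum_closed zer_closed zer_residuum)
      then show ?thesis using True by (simp add: residuum_eq_one_iff below_one one_residuum)
    next
      case False
      then show ?thesis using x by (simp add: zer_residuum mt_closed residuum_closed zer_closed)
    qed
    show ?thesis using \<alpha> 1 2 by (auto simp: zer_residuum zer_closed)
  qed
  have new_rules: "eval ?B e \<gamma> = \<one>"
    if e: "evaluation A e" and \<pi>: "eval ?B e \<pi> = \<one>" and
      "(\<pi>, \<gamma>) = ((Var 0 \<^bold>\<leftrightarrow> Var 1) \<^bold>\<or> Var 2, (\<^bold>\<circ> (Var 0) \<^bold>\<leftrightarrow> \<^bold>\<circ> (Var 1)) \<^bold>\<or> Var 2) \<or>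
       (\<pi>, \<gamma>) = ((\<^bold>\<not> \<^bold>\<not> Var 0 \<^bold>\<and> (Var 0 \<^bold>\<rightarrow> Var 1)) \<^bold>\<or> Var 2, (\<^bold>\<circ> (Var 0) \<^bold>\<rightarrow> \<^bold>\<circ> (Var 1)) \<^bold>\<or> Var 2)"
    for e \<pi> \<gamma>
  proof -
    have x: "e n \<in> carrier A" for n using e by blast
    note closed = x c_closed mt_closed residuum_closed zer_closed
    from that(3) show ?thesis
    proof
      assume eq: "(\<pi>, \<gamma>) = ((Var 0 \<^bold>\<leftrightarrow> Var 1) \<^bold>\<or> Var 2, (\<^bold>\<circ> (Var 0) \<^bold>\<leftrightarrow> \<^bold>\<circ> (Var 1)) \<^bold>\<or> Var 2)"
      then have "eval ?B e (Var 0 \<^bold>\<leftrightarrow> Var 1) = \<one> \<or> e 2 = \<one>"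
        using \<pi> Or[of e "Var 0 \<^bold>\<leftrightarrow> Var 1" "Var 2"] by (simp add: closed)
      then have "e 0 = e 1 \<or> e 2 = \<one>"
        using below_antisym[OF x x] by (auto simp: mt_eq_one_iff closed residuum_eq_one_iff)
      then have "eval ?B e (\<^bold>\<circ> (Var 0) \<^bold>\<leftrightarrow> \<^bold>\<circ> (Var 1)) = \<one> \<or> e 2 = \<one>"
        using mt_idem[OF c_closed]
        by (auto simp: mt_eq_one_iff closed residuum_eq_one_iff below_def mt_idem)
      then show ?thesis
        using eq Or[of e "\<^bold>\<circ> (Var 0) \<^bold>\<leftrightarrow> \<^bold>\<circ> (Var 1)" "Var 2"] by (simp add: closed)
    next
      assume eq: "(\<pi>, \<gamma>) = ((\<^bold>\<not> \<^bold>\<not> Var 0 \<^bold>\<and> (Var 0 \<^bold>\<rightarrow> Var 1)) \<^bold>\<or> Var 2,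
        (\<^bold>\<circ> (Var 0) \<^bold>\<rightarrow> \<^bold>\<circ> (Var 1)) \<^bold>\<or> Var 2)"
      then have "eval ?B e (\<^bold>\<not> \<^bold>\<not> Var 0 \<^bold>\<and> (Var 0 \<^bold>\<rightarrow> Var 1)) = \<one> \<or> e 2 = \<one>"
        using \<pi> Or[of e "\<^bold>\<not> \<^bold>\<not> Var 0 \<^bold>\<and> (Var 0 \<^bold>\<rightarrow> Var 1)" "Var 2"] by (simp add: closed)
      then consider "e 2 = \<one>" | "(e 0 \<leadsto> \<^bold>\<bottom>) \<leadsto> \<^bold>\<bottom> = \<one>" "e 0 \<preceq> e 1"
        by (auto simp: mt_eq_one_iff closed residuum_eq_one_iff)
      then have "eval ?B e (\<^bold>\<circ> (Var 0) \<^bold>\<rightarrow> \<^bold>\<circ> (Var 1)) = \<one> \<or> e 2 = \<one>"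
      proof cases
        case 2
        have "?c (e 0) \<preceq> ?c (e 1)"
        proof (cases "e 0 \<in> {\<^bold>\<bottom>, \<one>}")
          case True
          have "e 1 = \<one>"
          proof (cases "e 0 = \<^bold>\<bottom>")
            case True
            \<comment> \<open>Here \<open>\<not>\<not> 0 = 1\<close> reads \<open>0 = 1\<close>, so the chain is trivial.\<close>
            then have "\<^bold>\<bottom> = \<one>" using 2 zer_residuum[OF zer_closed] one_residuum[OF zer_closed] by simp
            then show ?thesis using zer_below[OF x, of 1] one_below_iff[OF x, of 1] by simp
          next
            case False
            then show ?thesis using True 2 one_below_iff[OF x, of 1] by simp
          qed
          then show ?thesis using below_one[OF c_closed] by simp
        next
          case False
          then show ?thesis using zer_below[OF c_closed] by simp
        qed
        then show ?thesis using residuum_eq_one_iff[OF c_closed c_closed] by simp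
      qed simp
      then show ?thesis
        using eq Or[of e "\<^bold>\<circ> (Var 0) \<^bold>\<rightarrow> \<^bold>\<circ> (Var 1)" "Var 2"] by (simp add: closed)
    qed
  qed
  show ?thesis
    unfolding is_algebra_def
  proof (intro conjI allI impI ballI)
    show "mtl_algebra ?B" by (rule mtl_algebra_circ) unfold_locales
  next
    fix c n xs assume "arity (dat_logic L) c = Some n" "length xs = n" "set xs \<subseteq> carrier ?B"
    then show "ops ?B c xs \<in> carrier ?B"
      using algebra_ops_closed[OF A] by (cases c) (auto simp: dat_logic_simps zer_closed)
  next
    fix e \<alpha> assume "evaluation ?B e" "\<alpha> \<in> axioms (dat_logic L)"
    then show "eval ?B e \<alpha> = \<one>\<^bsub>?B\<^esub>"
      using new_axioms algebra_axiom[OF A] unfolding dat_logic_simps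
      by (auto simp del: eval.simps)
  next
    fix e r assume e: "evaluation ?B e" and r: "r \<in> rules (dat_logic L)"
    obtain P \<gamma> where r_eq: "r = (P, \<gamma>)" by (cases r)
    have "eval ?B e \<gamma> = \<one>" if P: "\<forall>\<pi> \<in> P. eval ?B e \<pi> = \<one>"
    proof -
      consider Q \<delta> where "(Q, \<delta>) \<in> rules L" "P = map_fm Old ` Q" "\<gamma> = map_fm Old \<delta>"
        | "P = {(Var 0 \<^bold>\<leftrightarrow> Var 1) \<^bold>\<or> Var 2}" "\<gamma> = (\<^bold>\<circ> (Var 0) \<^bold>\<leftrightarrow> \<^bold>\<circ> (Var 1)) \<^bold>\<or> Var 2"
        | "P = {(\<^bold>\<not> \<^bold>\<not> Var 0 \<^bold>\<and> (Var 0 \<^bold>\<rightarrow> Var 1)) \<^bold>\<or> Var 2}"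
          "\<gamma> = (\<^bold>\<circ> (Var 0) \<^bold>\<rightarrow> \<^bold>\<circ> (Var 1)) \<^bold>\<or> Var 2"
        using r unfolding r_eq dat_logic_simps
        by (elim UnE imageE insertE emptyE) (simp_all split: prod.split_asm)
      then show ?thesis
      proof cases
        case 1
        then show ?thesis using P e algebra_rule[OF A _ 1(1), of e] by simp
      qed (use P e new_rules in \<open>simp_all del: eval.simps\<close>)
    qed
    then show "case r of (P, \<gamma>) \<Rightarrow>
        (\<forall>\<pi> \<in> P. eval ?B e \<pi> = \<one>\<^bsub>?B\<^esub>) \<longrightarrow> eval ?B e \<gamma> = \<one>\<^bsub>?B\<^esub>"
      by (simp add: r_eq)
  qed
qed

lemma eval_two_valued:
  assumes "mtl_algebra A" and "wff Map.empty \<phi>"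
  shows "eval A (\<lambda>n. if v n then \<one>\<^bsub>A\<^esub> else \<^bold>\<bottom>\<^bsub>A\<^esub>) \<phi> = (if truth v \<phi> then \<one>\<^bsub>A\<^esub> else \<^bold>\<bottom>\<^bsub>A\<^esub>)"
proof -
  interpret mtl_algebra A by fact
  show ?thesis
    using assms(2)
    by (induction \<phi>) (auto simp: zer_closed zer_mt one_mt zer_mult one_residuum zer_residuum
        residuum_eq_one_iff below_one zer_below)
qed

text \<open>A logic that is not SMTL leaves some formula unproved. By semilinearity it fails in a chain,
  whereas nothing fails in a chain with \<open>0 = 1\<close>.\<close>

lemma not_smtl_nontrivial_chain:
  fixes L :: "'c logic"
  assumes "semilinear L" and "\<not> smtl_logic L"
  obtains A :: "('c fm set, 'c) alg" where "is_chain L A" "\<one>\<^bsub>A\<^esub> \<noteq> \<^bold>\<bottom>\<^bsub>A\<^esub>"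
proof -
  obtain \<phi> where "wff (arity L) \<phi>" "\<not> \<turnstile>\<^bsub>L\<^esub> \<phi> \<^bold>\<and> \<^bold>\<not> \<phi> \<^bold>\<rightarrow> \<^bold>0"
    using assms(2) by (auto simp: smtl_logic_def)
  then obtain \<psi> where \<psi>: "wff (arity L) \<psi>" "\<not> \<turnstile>\<^bsub>L\<^esub> \<psi>"
    by (metis wff.simps(2,3,5))
  then have "\<not> chain_consequence TYPE('c fm set) L {} \<psi>"
    using assms(1) by (auto simp: semilinear_def)
  then obtain A :: "('c fm set, 'c) alg" and e
    where A: "is_chain L A" and e: "evaluation A e" and neq: "eval A e \<psi> \<noteq> \<one>\<^bsub>A\<^esub>"
    unfolding chain_consequence_def by blast
  interpret mtl_algebra A using A by (simp add: is_chain_def is_algebra_def)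
  have x: "eval A e \<psi> \<in> carrier A"
    using A e \<psi>(1) by (auto simp: is_chain_def intro: eval_closed)
  have "\<one>\<^bsub>A\<^esub> \<noteq> \<^bold>\<bottom>\<^bsub>A\<^esub>"
    using zer_below[OF x] one_below_iff[OF x] neq by metis
  with A show thesis by (rule that)
qed

section \<open>Recovering classical logic\<close>

text \<open>The schemata of \<open>L\<close> reappear in the expanded language, and renaming connectives leaves the
  schemata of MTL unchanged.\<close>

lemma mtl_embed_dat:
  assumes "core_expansion_of_mtl L" and "derives (mtl (arity (dat_logic L))) \<Gamma> \<phi>"
  shows "derives (dat_logic L) \<Gamma> \<phi>"
proof (rule mtl_embed[OF assms(2)])
  have L: "mtl_axioms \<subseteq> axioms L" "modus_ponens \<in> rules L"
    using assms(1) by (simp_all add: core_expansion_of_mtl_def)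
  have "modus_ponens = (case modus_ponens of (P, \<gamma>) \<Rightarrow> (map_fm Old ` P, map_fm Old \<gamma>))"
    by (simp add: modus_ponens_def)
  then show "modus_ponens \<in> rules (dat_logic L)"
    using L(2) unfolding dat_logic_simps by blast
  fix \<alpha> :: "'a circ fm" and \<sigma> :: "nat \<Rightarrow> 'a circ fm"
  assume \<alpha>: "\<alpha> \<in> mtl_axioms" and \<sigma>: "\<And>n. wff (arity (dat_logic L)) (\<sigma> n)"
  have "mtl_axioms = map_fm Old ` mtl_axioms" by (simp add: mtl_axioms_def Let_def)
  then have "\<alpha> \<in> axioms (dat_logic L)" using \<alpha> L(1) unfolding dat_logic_simps by blast
  then show "derives (dat_logic L) \<Gamma> (subst \<sigma> \<alpha>)" using \<sigma> by (rule derives.axiom_instance)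
qed

text \<open>The logic with \<open>\<circ>\<close> has rules beyond modus ponens, so the local deduction theorem does not apply
  to it directly. Its theorems are therefore taken as hypotheses of an MTL derivation; discharging the
  conjunction of the \<open>\<circ>p\<close> there leaves only theorems as hypotheses, and these are cut.\<close>

lemma dat_proves_tautology:
  assumes L: "core_expansion_of_mtl L" and \<phi>: "wff Map.empty \<phi>" and "\<And>v. truth v \<phi>"
    and ps: "set ps = vars \<phi>"
  shows "\<exists>k\<ge>1. \<turnstile>\<^bsub>dat_logic L\<^esub> fpow (big_and (map (\<lambda>p. \<^bold>\<circ> (Var p)) ps)) k \<^bold>\<rightarrow> \<phi>"
proof -
  let ?M = "dat_logic L" and ?D = "big_and (map (\<lambda>p. \<^bold>\<circ> (Var p)) ps)"
  let ?T = "{\<psi>. \<turnstile>\<^bsub>?M\<^esub> \<psi>}"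
  have D: "wff (arity ?M) ?D"
    by (induction ps rule: induct_list012) (simp_all add: dat_logic_simps)
  have "derives (mtl (arity ?M)) (insert ?D ?T) \<phi>"
  proof (rule derives_cut[OF tautology_from_excluded_middle[OF \<phi> assms(3)]])
    fix \<gamma> :: "'a circ fm"
    assume "\<gamma> \<in> (\<lambda>p. Var p \<^bold>\<or> \<^bold>\<not> Var p) ` vars \<phi>"
    then obtain p where p: "p \<in> set ps" "\<gamma> = Var p \<^bold>\<or> \<^bold>\<not> Var p" using ps by blast
    have "derives (mtl (arity ?M)) (insert ?D ?T) (?D \<^bold>\<rightarrow> \<^bold>\<circ> (Var p))"
      using p(1) by (intro mtl_big_and) (auto simp: dat_logic_simps)
    moreover have "derives (mtl (arity ?M)) (insert ?D ?T) ?D"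
      using D by (intro derives.hypothesis) auto
    moreover have "derives (mtl (arity ?M)) (insert ?D ?T) (\<^bold>\<circ> (Var p) \<^bold>\<rightarrow> Var p \<^bold>\<or> \<^bold>\<not> Var p)"
    proof (rule derives.hypothesis)
      have "\<turnstile>\<^bsub>?M\<^esub> subst (\<lambda>_. Var p) (\<^bold>\<circ> (Var 0) \<^bold>\<rightarrow> Var 0 \<^bold>\<or> \<^bold>\<not> (Var 0))"
        by (rule derives.axiom_instance) (auto simp: dat_logic_simps)
      then show "\<^bold>\<circ> (Var p) \<^bold>\<rightarrow> Var p \<^bold>\<or> \<^bold>\<not> Var p \<in> insert ?D ?T" by simp
    qed (simp add: dat_logic_simps)
    ultimately show "derives (mtl (arity ?M)) (insert ?D ?T) \<gamma>" using mtl_mp p(2) by blast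
  qed
  then obtain k where "k \<ge> 1" "derives (mtl (arity ?M)) ?T (fpow ?D k \<^bold>\<rightarrow> \<phi>)"
    using mtl_local_deduction[OF _ D] by blast
  then show ?thesis
    using derives_cut[OF mtl_embed_dat[OF L]] by blast
qed

text \<open>At values \<open>0\<close> and \<open>1\<close> of the variables every \<open>\<circ>p\<close> is \<open>1\<close>, hence so is the premise.\<close>

lemma dat_theorem_tautology:
  assumes L: "semilinear L" "\<not> smtl_logic L" and \<phi>: "wff Map.empty \<phi>"
    and provable: "\<turnstile>\<^bsub>dat_logic L\<^esub> fpow (big_and (map (\<lambda>p. \<^bold>\<circ> (Var p)) ps)) k \<^bold>\<rightarrow> \<phi>"
  shows "truth v \<phi>"
proof -
  obtain A :: "('a fm set, 'a) alg" where A: "is_chain L A" and neq: "\<one>\<^bsub>A\<^esub> \<noteq> \<^bold>\<bottom>\<^bsub>A\<^esub>"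
    using not_smtl_nontrivial_chain[OF L] by blast
  let ?B = "circ_algebra A" and ?e = "\<lambda>n. if v n then \<one>\<^bsub>A\<^esub> else \<^bold>\<bottom>\<^bsub>A\<^esub>"
  have B: "is_algebra (dat_logic L) ?B" using A by (rule circ_algebra_of_chain)
  interpret mtl_algebra ?B using B by (simp add: is_algebra_def)
  have one: "\<one>\<^bsub>A\<^esub> \<in> carrier A" using one_closed by simp
  have "evaluation ?B ?e" using one zer_closed by auto
  from algebra_sound[OF B this provable]
  have "eval ?B ?e (fpow (big_and (map (\<lambda>p. \<^bold>\<circ> (Var p)) ps)) k \<^bold>\<rightarrow> \<phi>) = \<one>\<^bsub>A\<^esub>" by simp
  moreover have "eval ?B ?e (big_and (map (\<lambda>p. \<^bold>\<circ> (Var p)) ps)) = \<one>\<^bsub>A\<^esub>"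
    using zer_residuum[OF zer_closed] mt_idem[OF one_closed]
    by (induction ps rule: induct_list012) auto
  then have "eval ?B ?e (fpow (big_and (map (\<lambda>p. \<^bold>\<circ> (Var p)) ps)) k) = \<one>\<^bsub>A\<^esub>"
    using zer_residuum[OF zer_closed] l_one[OF one_closed]
    by (induction k rule: induct_nat_012) auto
  moreover have "eval ?B ?e \<phi> = (if truth v \<phi> then \<one>\<^bsub>A\<^esub> else \<^bold>\<bottom>\<^bsub>A\<^esub>)"
    using eval_two_valued[OF mtl_algebra_axioms \<phi>, of v, unfolded circ_algebra_simps] .
  ultimately show ?thesis
    using neq one_residuum[OF zer_closed] by (auto split: if_splits)
qed

theorem proposition6p3:
  fixes L :: "'c logic" and \<phi> :: "'c circ fm" and ps :: "nat list"
  assumes "core_expansion_of_mtl L"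
    and "semilinear L"
    and "\<not> smtl_logic L"
    and "wff Map.empty \<phi>"
    and "distinct ps" and "set ps = vars \<phi>"
  shows "\<turnstile>\<^bsub>cpl\<^esub> \<phi> \<longleftrightarrow>
    (\<exists>k\<ge>1. \<turnstile>\<^bsub>dat_logic L\<^esub> fpow (big_and (map (\<lambda>p. \<^bold>\<circ> (Var p)) ps)) k \<^bold>\<rightarrow> \<phi>)"
proof
  assume "\<turnstile>\<^bsub>cpl\<^esub> \<phi>"
  then show "\<exists>k\<ge>1. \<turnstile>\<^bsub>dat_logic L\<^esub> fpow (big_and (map (\<lambda>p. \<^bold>\<circ> (Var p)) ps)) k \<^bold>\<rightarrow> \<phi>"
    using dat_proves_tautology cpl_sound assms(1,4,6) by blast
next
  assume "\<exists>k\<ge>1. \<turnstile>\<^bsub>dat_logic L\<^esub> fpow (big_and (map (\<lambda>p. \<^bold>\<circ> (Var p)) ps)) k \<^bold>\<rightarrow> \<phi>"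
  then show "\<turnstile>\<^bsub>cpl\<^esub> \<phi>"
    using cpl_complete dat_theorem_tautology assms(2-4) by blast
qed

end
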